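(* Let $\beta,\gamma\in(0,1)$ with $\beta+\gamma=1$. Let $ds^2$ be a reducible spherical conical metric on the Riemann sphere $\bar{\mathbb{C}}=\mathbb{C}\cup\{\infty\}$ with exactly three cone points, of angles $4\pi$, $2\pi\beta$, $2\pi\gamma$ (the "heart shape"). Place the cone point of angle $4\pi$ at $z=0$, and choose the coordinate so that $\infty$ is a pole of the associated character 1-form with residue $-1$ (a smooth point of $ds^2$). Then, up to a change of coordinate $z\mapsto pz$ with $p\in\mathbb{C}\setminus\{0\}$, the character 1-form of $ds^2$ is $$\omega=\frac{z}{(z-1)\left(z+\frac{\gamma}{\beta}\right)}\,dz,$$ and there is a real one-parameter family of such metrics, given for $c\in\mathbb{R}$ by $$ds^{2}=\frac{4e^{c}\,|z-1|^{2(\beta-1)}\,\left|z+\tfrac{\gamma}{\beta}\right|^{2(\gamma-1)}\,|z|^{2}}{\left[1+e^{c}\,|z-1|^{2\beta}\,\left|z+\tfrac{\gamma}{\beta}\right|^{2\gamma}\right]^{2}}\,|dz|^2 .$$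
   Context: A conical metric on a compact Riemann surface $\mathcal{M}$ is a metric smooth away from finitely many points $p_k$, near each of which it has the form $dr^2+\beta_k^2r^2d\theta^2$ (cone angle $2\pi\beta_k$); it is spherical if it has constant Gaussian curvature $1$. Away from cone points such a metric is locally the pullback $F^*\!\left(\frac{4|dw|^2}{(1+|w|^2)^2}\right)$ of the round metric by a multivalued locally univalent meromorphic function $F$ (the developing map); the metric is called reducible if the monodromy of $F$ can be chosen to lie in the diagonal subgroup $\{w\mapsto e^{i\theta}w\}\cong U(1)$ of $PSU(2)$. For a reducible spherical conical metric there is an associated character 1-form $\omega$: an Abelian differential of the third kind (meromorphic 1-form with only simple poles) on $\mathcal{M}$, all of whose residues are nonzero real numbers and whose real part is exact off its poles, together with a smooth function $\Phi:\mathcal{M}\setminus\{\text{poles of }\omega\}\to(0,4)$ satisfying $\frac{4\,d\Phi}{\Phi(4-\Phi)}=\omega+\overline{\omega}$, such that $ds^2=\frac{\Phi(4-\Phi)}{4}\,\omega\overline{\omega}$. A zero of $\omega$ of order $m$ is a cone point of angle $2\pi(m+1)$; a pole $p$ is a cone point of angle $2\pi|\mathrm{Res}_p\omega|$, and a smooth point if $\mathrm{Res}_p\omega=\pm1$. *)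

theory Defs
  imports "HOL-Complex_Analysis.Complex_Analysis"
begin

text \<open>Conformal metrics on the Riemann sphere are described in the standard
coordinate z of the complex plane by a density rho, ds^2 = rho(z) |dz|^2;
near infinity the coordinate w = 1/z is used, in which the density is
rho(1/w) / |w|^4.\<close>

definition dx :: "(complex \<Rightarrow> real) \<Rightarrow> complex \<Rightarrow> real" where
  "dx u z = frechet_derivative u (at z) 1"

definition dy :: "(complex \<Rightarrow> real) \<Rightarrow> complex \<Rightarrow> real" where
  "dy u z = frechet_derivative u (at z) \<i>"

fun Ck_on :: "nat \<Rightarrow> complex set \<Rightarrow> (complex \<Rightarrow> real) \<Rightarrow> bool" where
  "Ck_on 0 S u = continuous_on S u"
| "Ck_on (Suc k) S u =
     ((\<forall>z\<in>S. u differentiable (at z)) \<and> continuous_on S u \<and>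
      Ck_on k S (dx u) \<and> Ck_on k S (dy u))"

definition smooth_on :: "complex set \<Rightarrow> (complex \<Rightarrow> real) \<Rightarrow> bool" where
  "smooth_on S u \<longleftrightarrow> open S \<and> (\<forall>k. Ck_on k S u)"

definition laplacian :: "(complex \<Rightarrow> real) \<Rightarrow> complex \<Rightarrow> real" where
  "laplacian u z = dx (dx u) z + dy (dy u) z"

definition gauss_curv :: "(complex \<Rightarrow> real) \<Rightarrow> complex \<Rightarrow> real" where
  "gauss_curv \<rho> z = - laplacian (\<lambda>x. ln (\<rho> x)) z / (2 * \<rho> z)"

text \<open>p is a cone point of angle 2 pi theta: rho = |z-p|^(2(theta-1)) e^(2u), u continuous.\<close>
definition cone_point :: "(complex \<Rightarrow> real) \<Rightarrow> complex \<Rightarrow> real \<Rightarrow> bool" where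
  "cone_point \<rho> p \<theta> \<longleftrightarrow>
     (\<exists>r>0. \<exists>h. continuous_on (ball p r) h \<and> (\<forall>z\<in>ball p r. h z > 0) \<and>
        (\<forall>z\<in>ball p r - {p}. \<rho> z = cmod (z - p) powr (2 * (\<theta> - 1)) * h z))"

definition smooth_at_infinity :: "(complex \<Rightarrow> real) \<Rightarrow> bool" where
  "smooth_at_infinity \<rho> \<longleftrightarrow>
     (\<exists>r>0. \<exists>h. smooth_on (ball 0 r) h \<and> (\<forall>w\<in>ball 0 r. h w > 0) \<and>
        (\<forall>w\<in>ball 0 r - {0}. h w = \<rho> (1 / w) / cmod w ^ 4))"

text \<open>A local branch of a developing map: a locally univalent holomorphic G on a
domain U with rho = G^*(round metric). A branch is tagged by a boolean b: b = False
means G is a branch of the (meromorphic) developing map F, b = True means G = 1/F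
(this handles the poles of F; the round metric is invariant under w \<mapsto> 1/w).\<close>
definition dev_branch :: "(complex \<Rightarrow> real) \<Rightarrow> complex set \<Rightarrow> (complex \<Rightarrow> complex) \<Rightarrow> bool" where
  "dev_branch \<rho> U G \<longleftrightarrow> open U \<and> connected U \<and> G holomorphic_on U \<and>
     (\<forall>z\<in>U. deriv G z \<noteq> 0 \<and>
        \<rho> z = 4 * (cmod (deriv G z))\<^sup>2 / (1 + (cmod (G z))\<^sup>2)\<^sup>2)"

text \<open>Reducibility: the multivalued developing map on the complement of the cone set C
has monodromy in U(1) = {w \<mapsto> e^(i theta) w}, i.e. it is given by a family of branches
covering the complement of C, any two of which differ on each connected component of
their common domain by a rotation.\<close>
definition reducible :: "(complex \<Rightarrow> real) \<Rightarrow> complex set \<Rightarrow> bool" where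
  "reducible \<rho> C \<longleftrightarrow>
     (\<exists>D :: (complex set \<times> bool \<times> (complex \<Rightarrow> complex)) set.
        (\<Union>(U, b, G)\<in>D. U) = - C \<and>
        (\<forall>(U, b, G)\<in>D. dev_branch \<rho> U G) \<and>
        (\<forall>(U1, b1, G1)\<in>D. \<forall>(U2, b2, G2)\<in>D. \<forall>V\<in>components (U1 \<inter> U2).
           \<exists>\<theta>::real. \<forall>z\<in>V.
             (if b1 = b2 then G1 z = cis \<theta> * G2 z else G1 z * G2 z = cis \<theta>)))"

definition heart_metric ::
  "real \<Rightarrow> real \<Rightarrow> (complex \<Rightarrow> real) \<Rightarrow> complex \<Rightarrow> complex \<Rightarrow> bool" where
  "heart_metric \<beta> \<gamma> \<rho> a b \<longleftrightarrow>
     a \<noteq> 0 \<and> b \<noteq> 0 \<and> a \<noteq> b \<and>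
     smooth_on (- {0, a, b}) \<rho> \<and> (\<forall>z\<in>- {0, a, b}. \<rho> z > 0) \<and>
     (\<forall>z\<in>- {0, a, b}. gauss_curv \<rho> z = 1) \<and>
     cone_point \<rho> 0 2 \<and> cone_point \<rho> a \<beta> \<and> cone_point \<rho> b \<gamma> \<and>
     smooth_at_infinity \<rho> \<and>
     reducible \<rho> {0, a, b}"

definition simple_pole :: "(complex \<Rightarrow> complex) \<Rightarrow> complex \<Rightarrow> bool" where
  "simple_pole f p \<longleftrightarrow>
     (\<exists>r>0. \<exists>g. g holomorphic_on ball p r \<and> g p \<noteq> 0 \<and>
        (\<forall>z\<in>ball p r - {p}. f z = g z / (z - p)))"

text \<open>The 1-form f(z) dz written in the chart w = 1/z at infinity.\<close>
definition at_inf :: "(complex \<Rightarrow> complex) \<Rightarrow> complex \<Rightarrow> complex" where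
  "at_inf f w = - f (1 / w) / w\<^sup>2"

text \<open>omega = f(z) dz is a character 1-form of rho (with finite pole set P): an Abelian
differential of the third kind on the sphere with nonzero real residues, whose real part
is exact off the poles, and Phi : (sphere minus poles) \<rightarrow> (0,4) with
4 dPhi / (Phi (4 - Phi)) = omega + conj omega and rho = Phi (4 - Phi)/4 |f|^2.\<close>
definition character_form :: "(complex \<Rightarrow> real) \<Rightarrow> (complex \<Rightarrow> complex) \<Rightarrow> bool" where
  "character_form \<rho> f \<longleftrightarrow>
     (\<exists>P. finite P \<and> f holomorphic_on (- P) \<and>
        (\<forall>p\<in>P. simple_pole f p \<and> residue f p \<in> \<real> \<and> residue f p \<noteq> 0) \<and>
        ((\<exists>r>0. \<exists>g. g holomorphic_on ball 0 r \<and>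
            (\<forall>w\<in>ball 0 r - {0}. at_inf f w = g w)) \<or>
         (simple_pole (at_inf f) 0 \<and> residue (at_inf f) 0 \<in> \<real> \<and>
            residue (at_inf f) 0 \<noteq> 0)) \<and>
        (\<exists>h. \<forall>z\<in>- P. (h has_derivative (\<lambda>v. Re (f z * v))) (at z)) \<and>
        (\<exists>\<Phi>. smooth_on (- P) \<Phi> \<and>
           (\<forall>z\<in>- P. 0 < \<Phi> z \<and> \<Phi> z < 4 \<and>
              (\<Phi> has_derivative
                 (\<lambda>v. \<Phi> z * (4 - \<Phi> z) / 4 * (2 * Re (f z * v)))) (at z) \<and>
              \<rho> z = \<Phi> z * (4 - \<Phi> z) / 4 * (cmod (f z))\<^sup>2)))"

definition heart_form :: "real \<Rightarrow> real \<Rightarrow> complex \<Rightarrow> complex" where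
  "heart_form \<beta> \<gamma> z = z / ((z - 1) * (z + complex_of_real (\<gamma> / \<beta>)))"

definition heart_density :: "real \<Rightarrow> real \<Rightarrow> real \<Rightarrow> complex \<Rightarrow> real" where
  "heart_density \<beta> \<gamma> c z =
     4 * exp c * cmod (z - 1) powr (2 * (\<beta> - 1))
       * cmod (z + complex_of_real (\<gamma> / \<beta>)) powr (2 * (\<gamma> - 1)) * (cmod z)\<^sup>2
     / (1 + exp c * cmod (z - 1) powr (2 * \<beta>)
          * cmod (z + complex_of_real (\<gamma> / \<beta>)) powr (2 * \<gamma>))\<^sup>2"

end

theory Submission
  imports Defs
begin

text \<open>
  Writing X = \<Phi>/(4 - \<Phi>), the equation for \<Phi> says that ln X is a real potential of
  2 Re \<omega>, and the metric becomes 4 X |\<omega>|^2 / (1 + X)^2, the pullback of the round metric under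
  any branch of exp (\<integral> \<omega>), whose squared modulus is a multiple of X. These branches differ by rotations.

  Conversely, a cone angle smaller than 2 pi forces a pole of \<omega>, so a and b are poles. If 0 is no
  pole, comparison with the cone angle 4 pi makes it a simple zero. Dividing \<omega> by its zeros and
  multiplying by its poles gives an entire function without zeros which is asymptotic to a power of
  z, so it is constant by Liouville's theorem; counting degrees leaves \<omega> = z dz / ((z - a)(z - b)).
  Its residues are real with sum 1 and absolute values \<beta> and \<gamma>, which makes them \<beta> and \<gamma> and
  determines b/a.
\<close>

text \<open>The developing map is multivalued, so it is only used on balls. The global object is the
  single-valued real function \<open>L\<close> = ln X: smoothness, curvature and local branches all
  come from its differential 2 Re \<omega>. Its additive constant is the parameter c, and rescaling
  the coordinate merely shifts c. For uniqueness the obstacle is that the pole set of a character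
  form is not given. A further pole with residue 1 or -1 would be a smooth point of the metric, and
  the cone point 0 might itself be a pole with residue 2 or -2. Neither is excluded by looking at
  the point alone; the degree count does it. The residue -1 at infinity means that z f(z) tends to
  1, so finite poles outnumber finite zeros by one. Positivity of the density leaves room for one
  zero at most, hence for two finite poles at most, and a and b take both places. The signs of the
  residues at a and b are settled by \<beta> + \<gamma> = 1: the residues and their absolute values
  have the same sum, so none is negative.\<close>

section \<open>Functions of class \<open>C\<^sup>k\<close>\<close>

text \<open>Formally ln |g| is the real part of log g, whose differential is (g'/g) dz.
  Differentiating the norm directly avoids the choice of a branch of log.\<close>

lemma has_derivative_ln_cmod:
  fixes g :: "complex \<Rightarrow> complex"
  assumes "(g has_field_derivative g') (at z)" "g z \<noteq> 0"
  shows "((\<lambda>x. ln (cmod (g x))) has_derivative (\<lambda>v. Re (g' / g z * v))) (at z)"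
proof -
  have g: "(g has_derivative (\<lambda>v. g' * v)) (at z)"
    using assms(1) by (simp add: has_field_derivative_def)
  have n: "(norm has_derivative (\<lambda>h. h \<bullet> sgn (g z))) (at (g z))"
    by (rule has_derivative_norm[OF assms(2)])
  have c: "((\<lambda>x. cmod (g x)) has_derivative (\<lambda>v. (g' * v) \<bullet> sgn (g z))) (at z)"
    using diff_chain_at[OF g n] by (simp add: o_def)
  have eq: "(h \<bullet> sgn w) / cmod w = Re (h / w)" for h w :: complex
  proof -
    have "(h \<bullet> sgn w) / cmod w = (h \<bullet> w) / (cmod w)\<^sup>2"
      by (simp add: sgn_div_norm power2_eq_square divide_inverse)
    then show ?thesis
      by (simp only: Re_divide inner_complex_def cmod_power2)
  qed
  have "((\<lambda>x. ln (cmod (g x))) has_derivative (\<lambda>v. ((g' * v) \<bullet> sgn (g z)) * inverse (cmod (g z)))) (at z)"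
    using has_derivative_ln[OF _ c] assms(2) by simp
  then show ?thesis
    by (simp add: divide_inverse[symmetric] eq)
qed

lemma dx_eq: "(u has_derivative u') (at z) \<Longrightarrow> dx u z = u' 1"
  unfolding dx_def by (metis frechet_derivative_at)

lemma dy_eq: "(u has_derivative u') (at z) \<Longrightarrow> dy u z = u' \<i>"
  unfolding dy_def by (metis frechet_derivative_at)

text \<open>Derivatives at z see only values near z, hence the openness of \<open>S\<close>. This
  lets a density that agrees with a convenient formula off a finite set inherit its smoothness
  there.\<close>

lemma Ck_on_cong:
  assumes "open S" "\<And>z. z \<in> S \<Longrightarrow> u z = v z" "Ck_on k S u"
  shows "Ck_on k S v"
  using assms(2,3)
proof (induction k arbitrary: u v)
  case 0
  then show ?case using continuous_on_cong[of S S u v] by simp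
next
  case (Suc k)
  have d: "(v has_derivative frechet_derivative u (at z)) (at z)" if "z \<in> S" for z
  proof -
    have "(u has_derivative frechet_derivative u (at z)) (at z)"
      using Suc.prems(2) that frechet_derivative_works by auto
    from has_derivative_transform_within_open[OF this assms(1) that Suc.prems(1)] show ?thesis .
  qed
  have x: "dx u z = dx v z" and y: "dy u z = dy v z" if "z \<in> S" for z
    using dx_eq[OF d[OF that]] dy_eq[OF d[OF that]] by (simp_all add: dx_def dy_def)
  have "v differentiable (at z)" if "z \<in> S" for z
    using d[OF that] by (auto simp: differentiable_def)
  moreover have "continuous_on S v"
    using Suc.prems continuous_on_cong[of S S u v] by simp
  ultimately show ?case
    using Suc.IH[OF x] Suc.IH[OF y] Suc.prems(2) by (meson Ck_on.simps(2))
qed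

text \<open>Replaces the chosen \<open>frechet_derivative\<close> by any explicit derivative
  \<open>D\<close>, so that inductions on k can run on closed formulas.\<close>

lemma Ck_on_SucI:
  assumes "open S" "\<And>z. z \<in> S \<Longrightarrow> (u has_derivative D z) (at z)"
    "Ck_on k S (\<lambda>z. D z 1)" "Ck_on k S (\<lambda>z. D z \<i>)"
  shows "Ck_on (Suc k) S u"
proof -
  have "continuous_on S u"
    using assms(2) by (meson continuous_at_imp_continuous_on has_derivative_continuous)
  moreover have "Ck_on k S (dx u)"
    by (rule Ck_on_cong[OF assms(1) _ assms(3)]) (simp add: dx_eq[OF assms(2)])
  moreover have "Ck_on k S (dy u)"
    by (rule Ck_on_cong[OF assms(1) _ assms(4)]) (simp add: dy_eq[OF assms(2)])
  moreover have "\<forall>z\<in>S. u differentiable (at z)"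
    using assms(2) unfolding differentiable_def by blast
  ultimately show ?thesis
    by simp
qed

lemma Ck_on_SucD: "Ck_on (Suc k) S u \<Longrightarrow> Ck_on k S u"
proof (induction k arbitrary: u)
  case (Suc k)
  then show ?case
    by (meson Ck_on.simps(2))
qed simp

lemma Ck_on_has_derivative:
  assumes "Ck_on (Suc k) S u" "z \<in> S"
  shows "(u has_derivative frechet_derivative u (at z)) (at z)"
  using assms frechet_derivative_works by auto

lemma Ck_on_const: "open S \<Longrightarrow> Ck_on k S (\<lambda>z. c)"
proof (induction k arbitrary: c)
  case (Suc k)
  show ?case
    by (rule Ck_on_SucI[OF Suc.prems, where D = "\<lambda>z v. 0"]) (simp_all add: Suc)
qed simp

lemma Ck_on_add:
  assumes "open S" "Ck_on k S u" "Ck_on k S v"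
  shows "Ck_on k S (\<lambda>z. u z + v z)"
  using assms(2,3)
proof (induction k arbitrary: u v)
  case (Suc k)
  show ?case
    by (rule Ck_on_SucI[OF assms(1) has_derivative_add[OF Ck_on_has_derivative[OF Suc.prems(1)]
          Ck_on_has_derivative[OF Suc.prems(2)]]])
       (use Suc.prems in \<open>simp_all add: Suc.IH flip: dx_def dy_def\<close>)
qed (simp add: continuous_on_add)

lemma Ck_on_mult:
  assumes "open S" "Ck_on k S u" "Ck_on k S v"
  shows "Ck_on k S (\<lambda>z. u z * v z)"
  using assms(2,3)
proof (induction k arbitrary: u v)
  case (Suc k)
  note lower = Suc.prems[THEN Ck_on_SucD]
  have "Ck_on k S (\<lambda>z. u z * dx v z + dx u z * v z)" "Ck_on k S (\<lambda>z. u z * dy v z + dy u z * v z)"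
    by (intro Ck_on_add[OF assms(1)] Suc.IH lower; use Suc.prems in simp)+
  then show ?case
    using Ck_on_SucI[OF assms(1) has_derivative_mult[OF Ck_on_has_derivative[OF Suc.prems(1)]
          Ck_on_has_derivative[OF Suc.prems(2)]]]
    by (simp flip: dx_def dy_def)
qed (simp add: continuous_on_mult)

lemma Ck_on_inverse:
  assumes "open S" "Ck_on k S u" "\<And>z. z \<in> S \<Longrightarrow> u z \<noteq> 0"
  shows "Ck_on k S (\<lambda>z. inverse (u z))"
  using assms(2,3)
proof (induction k arbitrary: u)
  case (Suc k)
  have inv: "Ck_on k S (\<lambda>z. inverse (u z))"
    using Suc.IH[OF Ck_on_SucD[OF Suc.prems(1)] Suc.prems(2)] .
  have "Ck_on k S (\<lambda>z. (-1) * (inverse (u z) * dx u z * inverse (u z)))"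
       "Ck_on k S (\<lambda>z. (-1) * (inverse (u z) * dy u z * inverse (u z)))"
    using Suc.prems(1) by (intro Ck_on_mult[OF assms(1)] Ck_on_const[OF assms(1)] inv; simp)+
  then show ?case
    using Ck_on_SucI[OF assms(1) Deriv.has_derivative_inverse[OF Suc.prems(2) Ck_on_has_derivative[OF Suc.prems(1)]]]
    by (simp flip: dx_def dy_def)
qed (simp add: continuous_on_inverse)

text \<open>The partial derivatives of Re f are Re f' and Re (i f'), again real parts of holomorphic
  functions; the induction therefore varies \<open>f\<close>.\<close>

lemma Ck_on_Re_holomorphic:
  assumes "open S" "f holomorphic_on S"
  shows "Ck_on k S (\<lambda>z. Re (f z))"
  using assms(2)
proof (induction k arbitrary: f)
  case 0
  then show ?case using holomorphic_on_imp_continuous_on by (auto intro: continuous_intros)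
next
  case (Suc k)
  have d: "((\<lambda>z. Re (f z)) has_derivative (\<lambda>v. Re (deriv f z * v))) (at z)" if "z \<in> S" for z
    using holomorphic_derivI[OF Suc.prems assms(1) that, of UNIV]
    by (intro has_derivative_Re) (simp add: has_field_derivative_def)
  show ?case
    by (rule Ck_on_SucI[OF assms(1) d], assumption) 
      (intro Suc.IH holomorphic_on_mult holomorphic_on_const holomorphic_deriv Suc.prems assms(1))+
qed

lemma Ck_on_cmod_power2:
  assumes "open S" "f holomorphic_on S"
  shows "Ck_on k S (\<lambda>z. (cmod (f z))\<^sup>2)"
proof -
  \<comment> \<open>Im f is written as Re (-i f), so the previous lemma covers both squares.\<close>
  have "Ck_on k S (\<lambda>z. Re (f z) * Re (f z) + Re (- \<i> * f z) * Re (- \<i> * f z))"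
    by (intro Ck_on_add Ck_on_mult Ck_on_Re_holomorphic assms holomorphic_on_mult holomorphic_on_const)
  then show ?thesis
    by (simp add: cmod_power2) (simp add: power2_eq_square)
qed

text \<open>A bootstrap: the partial derivatives of exp L are exp L times real parts of holomorphic
  functions, so class k for exp L yields class k + 1, with nothing assumed about \<open>L\<close>
  beyond its differential.\<close>

lemma Ck_on_exp:
  assumes "open S" "f holomorphic_on S"
    and L: "\<And>z. z \<in> S \<Longrightarrow> (L has_derivative (\<lambda>v. 2 * Re (f z * v))) (at z)"
  shows "Ck_on k S (\<lambda>z. exp (L z))"
proof (induction k)
  case 0
  have "continuous_on S L"
    using L by (meson continuous_at_imp_continuous_on has_derivative_continuous)
  then show ?case by (auto intro: continuous_intros)
next
  case (Suc k)
  have d: "((\<lambda>z. exp (L z)) has_derivative (\<lambda>v. exp (L z) * (2 * Re (f z * v)))) (at z)" if "z \<in> S" for z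
    by (auto intro!: derivative_eq_intros L that)
  show ?case
    by (rule Ck_on_SucI[OF assms(1) d], assumption)
       (intro Ck_on_mult Ck_on_const assms(1,2) Suc Ck_on_Re_holomorphic holomorphic_on_mult holomorphic_on_const)+
qed

section \<open>Spherical metrics with a real potential\<close>

text \<open>If G' = f G and |G|^2 = exp L, this is 4 |G'|^2 / (1 + |G|^2)^2, the pullback of the
  round metric under G.\<close>

definition spherical_density :: "(complex \<Rightarrow> complex) \<Rightarrow> (complex \<Rightarrow> real) \<Rightarrow> complex \<Rightarrow> real" where
  "spherical_density f L z = 4 * exp (L z) / (1 + exp (L z))\<^sup>2 * (cmod (f z))\<^sup>2"

lemma one_plus_exp_neq_0 [simp]: "1 + exp (x::real) \<noteq> 0"
  by (smt (verit) exp_gt_zero)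

text \<open>A primitive of \<open>f\<close> may have imaginary periods around the holes of
  \<open>S\<close>. Only twice its real part is required to be single-valued, and this is
  \<open>L\<close>.\<close>

locale spherical_potential =
  fixes S :: "complex set" and f :: "complex \<Rightarrow> complex" and L :: "complex \<Rightarrow> real"
  assumes open_S: "open S" and hol: "f holomorphic_on S"
    and L: "\<And>z. z \<in> S \<Longrightarrow> (L has_derivative (\<lambda>v. 2 * Re (f z * v))) (at z)"
begin

lemma Ck_on_Phi: "Ck_on k S (\<lambda>z. 4 * exp (L z) / (1 + exp (L z)))"
  unfolding divide_inverse
  by (intro Ck_on_mult Ck_on_const Ck_on_inverse Ck_on_add Ck_on_exp[OF _ hol] L open_S) simp_all

lemma Ck_on_density: "Ck_on k S (spherical_density f L)"
proof -
  have "Ck_on k S (\<lambda>z. 4 * exp (L z) * inverse ((1 + exp (L z)) * (1 + exp (L z))) * (cmod (f z))\<^sup>2)"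
    by (intro Ck_on_mult Ck_on_const Ck_on_inverse Ck_on_add Ck_on_exp[OF _ hol] 
        Ck_on_cmod_power2 hol L open_S) simp_all
  then show ?thesis
    by (simp add: spherical_density_def[abs_def] divide_inverse power2_eq_square)
qed

section \<open>Positivity and curvature of the density\<close>

lemma density_pos: "f z \<noteq> 0 \<Longrightarrow> spherical_density f L z > 0"
  unfolding spherical_density_def
  by (intro mult_pos_pos divide_pos_pos) (auto simp: add_pos_pos)

text \<open>Off the zeros of \<open>f\<close>, ln \<rho> = ln 4 + L - 2 ln (1 + exp L) + 2 ln |f|.
  The last term is harmonic and so is L, hence the Laplacian comes entirely from ln (1 + exp L) and
  equals -2 \<rho>.\<close>

lemma gauss_curv_density:
  assumes "open U" "U \<subseteq> S" "\<And>z. z \<in> U \<Longrightarrow> f z \<noteq> 0" 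
    and \<rho>: "\<And>z. z \<in> U \<Longrightarrow> \<rho> z = spherical_density f L z" and z: "z \<in> U"
  shows "gauss_curv \<rho> z = 1"
proof -
  define q where "q = (\<lambda>z. deriv f z / f z)"
  \<comment> \<open>\<open>T\<close> is (1 - exp L) / (1 + exp L), the factor by which dL is
    multiplied in the differential of L - 2 ln (1 + exp L). This form needs the derivative of one
    inverse only.\<close>
  define T where "T = (\<lambda>z. 2 * inverse (1 + exp (L z)) - 1)"
  have q: "q holomorphic_on U"
    unfolding q_def using assms(1-3) hol
    by (intro holomorphic_intros holomorphic_deriv) (auto intro: holomorphic_on_subset)
  have X: "1 + exp (L w) > 0" for w by (simp add: add_pos_pos)
  have lnL: "((\<lambda>x. ln (\<rho> x)) has_derivative (\<lambda>v. 2 * T w * Re (f w * v) + 2 * Re (q w * v))) (at w)"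
    if w: "w \<in> U" for w
  proof -
    have Lw: "(L has_derivative (\<lambda>v. 2 * Re (f w * v))) (at w)"
      using L w assms(2) by blast
    have lnf: "((\<lambda>x. ln (cmod (f x))) has_derivative (\<lambda>v. Re (q w * v))) (at w)"
      unfolding q_def using w assms(1-3) hol open_S 
      by (intro has_derivative_ln_cmod holomorphic_derivI) auto
    have lnX: "((\<lambda>x. ln (1 + exp (L x))) has_derivative
        (\<lambda>v. exp (L w) * (2 * Re (f w * v)) / (1 + exp (L w)))) (at w)"
      using has_derivative_ln[OF X has_derivative_add[OF has_derivative_const has_derivative_exp[OF Lw]]]
      by (simp add: divide_inverse mult_ac)
    have "((\<lambda>x. ln 4 + L x - 2 * ln (1 + exp (L x)) + 2 * ln (cmod (f x))) has_derivative
       (\<lambda>v. 2 * T w * Re (f w * v) + 2 * Re (q w * v))) (at w)"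
      by (rule has_derivative_eq_rhs[OF has_derivative_add[OF has_derivative_diff[OF has_derivative_add[OF
            has_derivative_const Lw] has_derivative_mult_right[OF lnX]] has_derivative_mult_right[OF lnf]]])
         (use X[of w] in \<open>simp add: T_def q_def fun_eq_iff divide_simps, simp add: algebra_simps\<close>)
    then show ?thesis
    proof (rule has_derivative_transform_within_open[OF _ assms(1) w])
      fix x assume x: "x \<in> U"
      show "ln 4 + L x - 2 * ln (1 + exp (L x)) + 2 * ln (cmod (f x)) = ln (\<rho> x)"
        using assms(3)[OF x] X[of x]
        by (simp add: \<rho>[OF x] spherical_density_def ln_mult ln_div ln_realpow)
    qed
  qed
  have Ux: "dx (\<lambda>x. ln (\<rho> x)) w = 2 * T w * Re (f w) + 2 * Re (q w)"
    and Uy: "dy (\<lambda>x. ln (\<rho> x)) w = - (2 * T w * Im (f w) + 2 * Im (q w))" if "w \<in> U" for w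
    using dx_eq[OF lnL[OF that]] dy_eq[OF lnL[OF that]] by simp_all
  have zS: "z \<in> S" using z assms(2) by blast
  define T' where "T' = (\<lambda>v. - 4 * exp (L z) * Re (f z * v) / (1 + exp (L z))\<^sup>2)"
  have T': "(T has_derivative T') (at z)"
    unfolding T_def
    using has_derivative_diff[OF has_derivative_mult_right[OF Deriv.has_derivative_inverse[OF _ 
        has_derivative_add[OF has_derivative_const has_derivative_exp[OF L[OF zS]]]]] has_derivative_const, of 1 2 1]
    by (rule has_derivative_eq_rhs) (simp_all add: T'_def fun_eq_iff power2_eq_square divide_inverse)
  have fd: "(f has_derivative (\<lambda>v. deriv f z * v)) (at z)"
    using holomorphic_derivI[OF hol open_S zS] by (simp add: has_field_derivative_def)
  have qd: "(q has_derivative (\<lambda>v. deriv q z * v)) (at z)"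
    using holomorphic_derivI[OF q assms(1) z] by (simp add: has_field_derivative_def)
  have "((\<lambda>w. 2 * T w * Re (f w) + 2 * Re (q w)) has_derivative
     (\<lambda>v. 2 * T' v * Re (f z) + 2 * T z * Re (deriv f z * v) + 2 * Re (deriv q z * v))) (at z)"
    by (rule has_derivative_eq_rhs[OF has_derivative_add[OF has_derivative_mult[OF has_derivative_mult_right[OF T']
        has_derivative_Re[OF fd]] has_derivative_mult_right[OF has_derivative_Re[OF qd]]]])
      (simp add: fun_eq_iff)
  from has_derivative_transform_within_open[OF this assms(1) z Ux[symmetric]]
  have xx: "dx (dx (\<lambda>x. ln (\<rho> x))) z = 2 * T' 1 * Re (f z) + 2 * T z * Re (deriv f z) + 2 * Re (deriv q z)"
    by (simp add: dx_eq)
  have "((\<lambda>w. - (2 * T w * Im (f w) + 2 * Im (q w))) has_derivative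
     (\<lambda>v. - (2 * T' v * Im (f z) + 2 * T z * Im (deriv f z * v) + 2 * Im (deriv q z * v)))) (at z)"
    by (rule has_derivative_eq_rhs[OF has_derivative_minus[OF has_derivative_add[OF has_derivative_mult[OF has_derivative_mult_right[OF T']
        has_derivative_Im[OF fd]] has_derivative_mult_right[OF has_derivative_Im[OF qd]]]]])
      (simp add: fun_eq_iff)
  from has_derivative_transform_within_open[OF this assms(1) z Uy[symmetric]]
  have yy: "dy (dy (\<lambda>x. ln (\<rho> x))) z = - (2 * T' \<i> * Im (f z) + 2 * T z * Re (deriv f z) + 2 * Re (deriv q z))"
    by (simp add: dy_eq)
  \<comment> \<open>The terms with \<open>deriv f z\<close> and \<open>deriv q z\<close> occur with
    opposite signs in \<open>xx\<close> and \<open>yy\<close>, since i^2 = -1; only the terms with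
    \<open>T'\<close> survive.\<close>
  have "laplacian (\<lambda>x. ln (\<rho> x)) z = - 8 * exp (L z) / (1 + exp (L z))\<^sup>2 * (cmod (f z))\<^sup>2"
    unfolding laplacian_def xx yy T'_def cmod_power2 using X[of z]
    by (simp add: divide_simps) (simp add: algebra_simps power2_eq_square)
  then show ?thesis
    using density_pos[OF assms(3)[OF z]] unfolding gauss_curv_def \<rho>[OF z]
    by (auto simp: spherical_density_def)
qed

text \<open>A branch of the developing map is a multiple of the exponential of a primitive of f.\<close>
definition is_branch :: "complex set \<Rightarrow> (complex \<Rightarrow> complex) \<Rightarrow> bool" where
  "is_branch U G \<longleftrightarrow> G holomorphic_on U \<and>
     (\<forall>z\<in>U. deriv G z = f z * G z \<and> (cmod (G z))\<^sup>2 = exp (L z))"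

text \<open>On a ball \<open>f\<close> has a primitive F, and 2 Re F and \<open>L\<close> have the
  same differential, so they differ by a constant k. Subtracting k/2 from F before exponentiating
  makes the squared modulus exactly exp L.\<close>

lemma branch_exists:
  assumes "ball x r \<subseteq> S"
  shows "\<exists>G. is_branch (ball x r) G"
proof -
  obtain F where F: "\<And>z. z \<in> ball x r \<Longrightarrow> (F has_field_derivative f z) (at z within ball x r)"
    using holomorphic_convex_primitive'[of "ball x r" f] hol assms
    by (auto intro: holomorphic_on_subset)
  have F': "(F has_field_derivative f z) (at z)" if "z \<in> ball x r" for z
    using F[OF that] at_within_open[OF that] by simp
  have "((\<lambda>z. 2 * Re (F z) - L z) has_derivative (\<lambda>v. 0)) (at z within ball x r)" if z: "z \<in> ball x r" for z
  proof -
    have "(F has_derivative (\<lambda>v. f z * v)) (at z)"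
      using F'[OF z] by (simp add: has_field_derivative_def)
    moreover have "z \<in> S" using z assms by blast
    ultimately have "((\<lambda>z. 2 * Re (F z) - L z) has_derivative (\<lambda>v. 2 * Re (f z * v) - 2 * Re (f z * v))) (at z)"
      using L by (intro has_derivative_diff has_derivative_mult_right has_derivative_Re) blast+
    then show ?thesis by (simp add: has_derivative_at_withinI)
  qed
  then obtain k where k: "\<And>z. z \<in> ball x r \<Longrightarrow> 2 * Re (F z) - L z = k"
    using has_derivative_zero_constant[of "ball x r" "\<lambda>z. 2 * Re (F z) - L z"] by auto
  define G where "G = (\<lambda>z. exp (F z - of_real (k / 2)))"
  have dG: "(G has_field_derivative f z * G z) (at z)" if "z \<in> ball x r" for z
    unfolding G_def by (auto intro!: derivative_eq_intros F'[OF that])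
  have "G holomorphic_on ball x r"
    by (rule holomorphic_onI) (meson dG field_differentiable_at_within field_differentiable_def)
  moreover have "(cmod (G z))\<^sup>2 = exp (L z)" if "z \<in> ball x r" for z
  proof -
    have "(cmod (G z))\<^sup>2 = exp (2 * (Re (F z) - k / 2))"
      by (simp only: G_def norm_exp_eq_Re exp_double) simp
    also have "2 * (Re (F z) - k / 2) = L z" 
      using k[OF that] by (simp add: algebra_simps)
    finally show ?thesis .
  qed
  ultimately show ?thesis
    unfolding is_branch_def using DERIV_imp_deriv[OF dG] by blast
qed

lemma dev_branch_ball:
  assumes "is_branch (ball x r) G" "ball x r \<subseteq> S" "\<And>z. z \<in> ball x r \<Longrightarrow> f z \<noteq> 0"
    and "\<And>z. z \<in> ball x r \<Longrightarrow> \<rho> z = spherical_density f L z"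
  shows "dev_branch \<rho> (ball x r) G"
  unfolding dev_branch_def
proof (intro conjI ballI)
  fix z assume z: "z \<in> ball x r"
  have eq: "deriv G z = f z * G z" "(cmod (G z))\<^sup>2 = exp (L z)"
    using assms(1) z by (auto simp: is_branch_def)
  then have "G z \<noteq> 0" by auto
  then show "deriv G z \<noteq> 0" using eq assms(3)[OF z] by simp
  show "\<rho> z = 4 * (cmod (deriv G z))\<^sup>2 / (1 + (cmod (G z))\<^sup>2)\<^sup>2"
    unfolding assms(4)[OF z] spherical_density_def eq norm_mult power_mult_distrib by simp
qed (use assms in \<open>auto simp: is_branch_def\<close>)

text \<open>Both branches solve G' = f G, so their quotient is locally constant; equal moduli make
  the constant unimodular. It may change from one component of the overlap to another.\<close>

lemma branches_differ_by_rotation: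
  assumes "is_branch U1 G1" "is_branch U2 G2" "open U1" "open U2"
    and V: "V \<in> components (U1 \<inter> U2)"
  shows "\<exists>\<theta>::real. \<forall>z\<in>V. G1 z = cis \<theta> * G2 z"
proof -
  have VU: "V \<subseteq> U1" "V \<subseteq> U2" and V': "open V" "connected V" "V \<noteq> {}"
    using assms in_components_subset[OF V] in_components_connected[OF V] 
      in_components_nonempty[OF V] open_components[OF _ V] by auto
  have G: "(G1 has_field_derivative f z * G1 z) (at z)" "(G2 has_field_derivative f z * G2 z) (at z)"
    "(cmod (G1 z))\<^sup>2 = exp (L z)" "(cmod (G2 z))\<^sup>2 = exp (L z)" if "z \<in> V" for z
    using assms that VU holomorphic_derivI[of G1 U1 z UNIV] holomorphic_derivI[of G2 U2 z UNIV]
    unfolding is_branch_def by (auto dest: subsetD)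
  have nz: "G2 z \<noteq> 0" if "z \<in> V" for z using G(4)[OF that] by auto
  have const: "G1 z / G2 z = G1 y / G2 y" if "z \<in> V" "y \<in> V" for z y
  proof (rule has_derivative_zero_unique_connected[OF V'(1,2) _ that])
    fix x assume x: "x \<in> V"
    have "((\<lambda>z. G1 z / G2 z) has_field_derivative 0) (at x)"
      using DERIV_divide[OF G(1,2)[OF x] nz[OF x]] by (simp add: algebra_simps)
    then show "((\<lambda>z. G1 z / G2 z) has_derivative (\<lambda>x. 0)) (at x)"
      by (simp add: has_field_derivative_def fun_eq_iff lambda_zero)
  qed
  obtain y where y: "y \<in> V" using V'(3) by blast
  have "cmod (G1 y) = cmod (G2 y)"
    using G(3,4)[OF y] by (metis norm_ge_zero power2_eq_imp_eq)
  then have "cmod (G1 y / G2 y) = 1"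
    using nz[OF y] by (simp add: norm_divide)
  then have "G1 y / G2 y = cis (Arg (G1 y / G2 y))"
    using rcis_cmod_Arg[of "G1 y / G2 y"] by (simp add: rcis_def)
  then have "G1 z = cis (Arg (G1 y / G2 y)) * G2 z" if "z \<in> V" for z
    using const[OF that y] nz[OF that] by (metis nonzero_mult_div_cancel_right nonzero_eq_divide_eq)
  then show ?thesis by blast
qed

lemma reducible_density:
  assumes "open (- C)" "- C \<subseteq> S" "\<And>z. z \<notin> C \<Longrightarrow> f z \<noteq> 0"
    and "\<And>z. z \<notin> C \<Longrightarrow> \<rho> z = spherical_density f L z"
  shows "reducible \<rho> C"
proof -
  \<comment> \<open>All branches on all balls are taken. The tag is always \<open>False\<close>: the
    squared modulus exp L is finite and nonzero, so no branch has to be replaced by its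
    reciprocal.\<close>
  define D where "D = {(ball x r, False, G) | x r G. ball x r \<subseteq> - C \<and> is_branch (ball x r) G}"
  have "(\<Union>(U, b, G)\<in>D. U) = - C"
  proof (intro equalityI subsetI)
    fix z assume z: "z \<in> - C"
    obtain r where r: "r > 0" "ball z r \<subseteq> - C"
      using assms(1) z by (meson open_contains_ball)
    obtain G where "is_branch (ball z r) G"
      using branch_exists[of z r] r assms(2) by blast
    then have "(ball z r, False, G) \<in> D" unfolding D_def using r by blast
    moreover have "z \<in> ball z r" using r by simp
    ultimately show "z \<in> (\<Union>(U, b, G)\<in>D. U)" by blast
  qed (auto simp: D_def)
  moreover have "\<forall>(U, b, G)\<in>D. dev_branch \<rho> U G"
  proof safe
    fix U b G assume "(U, b, G) \<in> D"
    then obtain x r where "U = ball x r" "ball x r \<subseteq> - C" "is_branch (ball x r) G"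
      unfolding D_def by blast
    then show "dev_branch \<rho> U G"
      using assms(2-4) by (auto intro!: dev_branch_ball)
  qed
  moreover have "\<forall>(U1, b1, G1)\<in>D. \<forall>(U2, b2, G2)\<in>D. \<forall>V\<in>components (U1 \<inter> U2).
      \<exists>\<theta>::real. \<forall>z\<in>V. (if b1 = b2 then G1 z = cis \<theta> * G2 z else G1 z * G2 z = cis \<theta>)"
  proof safe
    fix U1 b1 G1 U2 b2 G2 V
    assume D: "(U1, b1, G1) \<in> D" "(U2, b2, G2) \<in> D" and V: "V \<in> components (U1 \<inter> U2)"
    from D have "is_branch U1 G1" "is_branch U2 G2" "open U1" "open U2" "b1 = b2"
      by (auto simp: D_def)
    with branches_differ_by_rotation[OF this(1-4) V]
    show "\<exists>\<theta>::real. \<forall>z\<in>V. (if b1 = b2 then G1 z = cis \<theta> * G2 z else G1 z * G2 z = cis \<theta>)"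
      by simp
  qed
  ultimately show ?thesis unfolding reducible_def by blast
qed

text \<open>Here \<Phi> = 4X / (1 + X) inverts X = \<Phi> / (4 - \<Phi>), and the range (0,4)
  reflects X > 0.\<close>

lemma Phi_of_potential:
  defines "\<Phi> \<equiv> \<lambda>z. 4 * exp (L z) / (1 + exp (L z))"
  assumes z: "z \<in> S"
  shows "0 < \<Phi> z" "\<Phi> z < 4" 
    "(\<Phi> has_derivative (\<lambda>v. \<Phi> z * (4 - \<Phi> z) / 4 * (2 * Re (f z * v)))) (at z)"
    "spherical_density f L z = \<Phi> z * (4 - \<Phi> z) / 4 * (cmod (f z))\<^sup>2"
proof -
  have X: "1 + exp (L z) > 0" by (simp add: add_pos_pos)
  show "0 < \<Phi> z" "\<Phi> z < 4" using X by (simp_all add: \<Phi>_def field_simps)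
  have \<Phi>: "\<Phi> z * (4 - \<Phi> z) / 4 = 4 * exp (L z) / (1 + exp (L z))\<^sup>2"
    using X by (simp add: \<Phi>_def divide_simps power2_eq_square)
  then show "spherical_density f L z = \<Phi> z * (4 - \<Phi> z) / 4 * (cmod (f z))\<^sup>2"
    by (simp add: spherical_density_def)
  \<comment> \<open>\<Phi> is rewritten as 4 - 4 / (1 + X), so that X occurs only once when
    differentiating.\<close>
  have "((\<lambda>z. 4 - 4 * inverse (1 + exp (L z))) has_derivative
      (\<lambda>v. \<Phi> z * (4 - \<Phi> z) / 4 * (2 * Re (f z * v)))) (at z)"
    using has_derivative_diff[OF has_derivative_const has_derivative_mult_right[OF 
        Deriv.has_derivative_inverse[OF _ has_derivative_add[OF has_derivative_const has_derivative_exp[OF L[OF z]]]]], of 1 4 4]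
    unfolding \<Phi> by (rule has_derivative_eq_rhs) (simp_all add: fun_eq_iff power2_eq_square divide_inverse)
  moreover have "4 - 4 * inverse (1 + exp (L x)) = \<Phi> x" for x
    using one_plus_exp_neq_0[of "L x"] by (simp add: \<Phi>_def field_simps)
  ultimately show "(\<Phi> has_derivative (\<lambda>v. \<Phi> z * (4 - \<Phi> z) / 4 * (2 * Re (f z * v)))) (at z)"
    by simp
qed

end

section \<open>The heart-shaped metrics\<close>

lemma simple_poleI:
  assumes "r > 0" "g holomorphic_on ball p r" "g p \<noteq> 0" "\<And>z. z \<in> ball p r \<Longrightarrow> z \<noteq> p \<Longrightarrow> f z = g z / (z - p)"
  shows "simple_pole f p" "residue f p = g p"
proof -
  show "simple_pole f p" unfolding simple_pole_def using assms by blast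
  have "\<forall>\<^sub>F z in at p. z \<in> ball p r - {p}"
    using assms(1) by (intro eventually_at_in_open) auto
  then have "\<forall>\<^sub>F z in at p. f z = g z / (z - p)"
    by (rule eventually_mono) (use assms(4) in blast)
  then have "residue f p = residue (\<lambda>z. g z / (z - p)) p"
    by (rule residue_cong) simp
  also have "\<dots> = g p"
    using residue_simple[of "ball p r" p g] assms(1,2) by simp
  finally show "residue f p = g p" .
qed

text \<open>Twice the real part of r log (z - a) + s log (z - b). The logarithms are multivalued,
  but for real residues this real part is not.\<close>

definition log_potential :: "complex \<Rightarrow> complex \<Rightarrow> real \<Rightarrow> real \<Rightarrow> complex \<Rightarrow> real" where
  "log_potential a b r s z = 2 * r * ln (cmod (z - a)) + 2 * s * ln (cmod (z - b))"

lemma Re_mult_of_real_left: "Re (of_real r * z) = r * Re z"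
  by simp

lemma has_derivative_log_potential:
  assumes "z \<noteq> a" "z \<noteq> b"
  shows "(log_potential a b r s has_derivative (\<lambda>v. 2 * Re ((of_real r / (z - a) + of_real s / (z - b)) * v))) (at z)"
proof -
  have D: "((\<lambda>x. x - w) has_field_derivative 1) (at z)" for w :: complex
    by (auto intro!: derivative_eq_intros)
  have "((\<lambda>z. 2 * r * ln (cmod (z - a)) + 2 * s * ln (cmod (z - b))) has_derivative 
      (\<lambda>v. 2 * r * Re (1 / (z - a) * v) + 2 * s * Re (1 / (z - b) * v))) (at z)"
    using assms by (intro has_derivative_add has_derivative_mult_right has_derivative_ln_cmod D) auto
  moreover have "2 * r * Re (1 / (z - a) * v) + 2 * s * Re (1 / (z - b) * v)
     = 2 * Re ((of_real r / (z - a) + of_real s / (z - b)) * v)" for v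
  proof -
    have "(of_real r / (z - a) + of_real s / (z - b)) * v = of_real r * (1 / (z - a) * v) + of_real s * (1 / (z - b) * v)"
      by (simp add: algebra_simps)
    then show ?thesis
      by (simp only: plus_complex.sel Re_complex_of_real Re_mult_of_real_left) simp
  qed
  ultimately show ?thesis
    by (simp only: log_potential_def[abs_def])
qed

lemma exp_log_potential:
  assumes "z \<noteq> a" "z \<noteq> b"
  shows "exp (c + log_potential a b r s z) = exp c * cmod (z - a) powr (2 * r) * cmod (z - b) powr (2 * s)"
  using assms by (simp add: log_potential_def exp_add powr_def)

lemma spherical_potential_log:
  assumes "\<And>z. z \<notin> {a, b} \<Longrightarrow> f z = of_real r / (z - a) + of_real s / (z - b)"
  shows "spherical_potential (- {a, b}) f (\<lambda>z. c + log_potential a b r s z)"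
proof
  show "open (- {a, b})" by (simp add: open_Compl)
  have "(\<lambda>z. of_real r / (z - a) + of_real s / (z - b)) holomorphic_on - {a, b}"
    by (intro holomorphic_intros) auto
  then show "f holomorphic_on - {a, b}"
    by (rule holomorphic_transform) (use assms in auto)
  fix z assume "z \<in> - {a, b}"
  then show "((\<lambda>z. c + log_potential a b r s z) has_derivative (\<lambda>v. 2 * Re (f z * v))) (at z)"
    using has_derivative_add[OF has_derivative_const has_derivative_log_potential, of z a b c r s] assms[of z]
    by (simp only: add_0 simp_thms) auto
qed

text \<open>exp L contributes |z - a|^(2t) and |f|^2 contributes 1 / |z - a|^2; together they give
  the exponent of a cone point of angle 2 pi t.\<close>

lemma powr_double_minus: 
  fixes x :: real assumes "x > 0" shows "x powr (2 * (t - 1)) = x powr (2 * t) / x\<^sup>2"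
  using assms by (simp add: right_diff_distrib powr_diff)

lemma ex_ball_avoiding_finite:
  "finite A \<Longrightarrow> p \<notin> A \<Longrightarrow> \<exists>r>0. \<forall>z\<in>ball p r. z \<notin> (A::complex set)"
  by (meson ComplD ComplI finite_imp_closed open_Compl openE subsetD)

section \<open>The explicit one-parameter family\<close>

locale heart =
  fixes \<beta> \<gamma> :: real
  assumes \<beta>: "0 < \<beta>" and \<gamma>: "0 < \<gamma>" and sum: "\<beta> + \<gamma> = 1"
begin

definition q :: complex where "q = - complex_of_real (\<gamma> / \<beta>)"

lemma q_neq: "q \<noteq> 0" "q \<noteq> 1" "1 \<noteq> q" "0 \<noteq> q"
proof -
  have "q = of_real (- (\<gamma> / \<beta>))" by (simp add: q_def)
  moreover have "- (\<gamma> / \<beta>) < 0" using \<beta> \<gamma> by simp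
  ultimately show "q \<noteq> 0" "q \<noteq> 1" "1 \<noteq> q" "0 \<noteq> q"
    by (smt (verit) of_real_eq_iff of_real_0 of_real_1)+
qed

lemma form_eq: "heart_form \<beta> \<gamma> z = z / ((z - 1) * (z - q))"
  by (simp add: heart_form_def q_def)

text \<open>These are the residues of z / ((z - 1)(z - q)) at 1 and q. The value of \<open>q\<close>
  is the one that makes the first equal to \<beta>; the two always add up to 1, which gives the
  second.\<close>

lemma residues: "1 / (1 - q) = of_real \<beta>" "q / (q - 1) = of_real \<gamma>"
proof -
  have "1 + \<gamma> / \<beta> = 1 / \<beta>" using \<beta> sum by (simp add: field_simps)
  then have "1 - q = of_real (1 / \<beta>)"
    unfolding q_def by (metis diff_minus_eq_add of_real_1 of_real_add)
  then show "1 / (1 - q) = of_real \<beta>" by simp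
  then show "q / (q - 1) = of_real \<gamma>" 
  proof -
    have "q / (q - 1) = 1 - 1 / (1 - q)" using q_neq by (simp add: field_simps)
    also have "\<dots> = of_real (1 - \<beta>)" using \<open>1 / (1 - q) = of_real \<beta>\<close> by simp
    also have "1 - \<beta> = \<gamma>" using sum by simp
    finally show ?thesis .
  qed
qed

lemma form_partial_fractions:
  assumes "z \<notin> {1, q}"
  shows "heart_form \<beta> \<gamma> z = of_real \<beta> / (z - 1) + of_real \<gamma> / (z - q)"
  unfolding form_eq residues[symmetric] using assms q_neq by (simp add: divide_simps) (simp add: algebra_simps)

definition pot :: "real \<Rightarrow> complex \<Rightarrow> real" where
  "pot c = (\<lambda>z. c + log_potential 1 q \<beta> \<gamma> z)"

sublocale spherical_potential "- {1, q}" "heart_form \<beta> \<gamma>" "pot c" for c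
  unfolding pot_def by (rule spherical_potential_log) (rule form_partial_fractions)

lemma density_eq:
  assumes "z \<notin> {1, q}"
  shows "heart_density \<beta> \<gamma> c z = spherical_density (heart_form \<beta> \<gamma>) (pot c) z"
proof -
  have "cmod (z - 1) > 0" "cmod (z - q) > 0" using assms by auto
  note eq = this[THEN powr_double_minus]
  have X: "exp (pot c z) = exp c * cmod (z - 1) powr (2 * \<beta>) * cmod (z - q) powr (2 * \<gamma>)"
    unfolding pot_def using assms by (intro exp_log_potential) auto
  have q: "z + complex_of_real (\<gamma> / \<beta>) = z - q" by (simp add: q_def)
  show ?thesis
    unfolding heart_density_def spherical_density_def q form_eq eq X norm_divide norm_mult
    by (simp add: power_divide power_mult_distrib mult_ac)
qed

text \<open>The exponents 2\<beta> and 2\<gamma> are positive, so the denominator is continuous and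
  positive even at 1 and q. Near each of the three points exactly one factor of the numerator is
  singular or vanishes, and it is the power required by the cone angle.\<close>

lemma cone_points: "cone_point (heart_density \<beta> \<gamma> c) 0 2" 
  "cone_point (heart_density \<beta> \<gamma> c) 1 \<beta>" "cone_point (heart_density \<beta> \<gamma> c) q \<gamma>"
proof -
  define A where "A = (\<lambda>z. exp c * cmod (z - 1) powr (2 * \<beta>) * cmod (z - q) powr (2 * \<gamma>))"
  have A: "1 + A z > 0" for z by (simp add: A_def add_pos_nonneg)
  have Ac: "continuous_on U A" for U unfolding A_def
    by (intro continuous_intros continuous_on_powr') (use \<beta> \<gamma> in auto)
  have den: "heart_density \<beta> \<gamma> c z = 4 * exp c * cmod (z - 1) powr (2 * (\<beta> - 1))
       * cmod (z - q) powr (2 * (\<gamma> - 1)) * (cmod z)\<^sup>2 / (1 + A z)\<^sup>2" for z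
    by (simp add: heart_density_def A_def q_def)
  show "cone_point (heart_density \<beta> \<gamma> c) 0 2"
  proof -
    obtain r where r: "r > 0" "\<And>z. z \<in> ball 0 r \<Longrightarrow> z \<notin> {1, q}" using ex_ball_avoiding_finite[of "{1,q}" 0] q_neq by auto
    then have n: "z \<noteq> 1" "z \<noteq> q" if "z \<in> ball 0 r" for z using r(2)[OF that] by auto
    define h where "h = (\<lambda>z. 4 * exp c * cmod (z - 1) powr (2 * (\<beta> - 1)) * cmod (z - q) powr (2 * (\<gamma> - 1)) / (1 + A z)\<^sup>2)"
    have "continuous_on (ball 0 r) h" unfolding h_def
      by (intro continuous_intros Ac) (use n A in \<open>auto simp: less_imp_neq[THEN not_sym]\<close>)
    moreover have "h z > 0" if "z \<in> ball 0 r" for z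
      using n[OF that] A[of z] by (simp add: h_def)
    moreover have "heart_density \<beta> \<gamma> c z = cmod (z - 0) powr (2 * (2 - 1)) * h z" if "z \<in> ball 0 r - {0}" for z
      using that by (simp add: den h_def powr_numeral)
    ultimately show ?thesis unfolding cone_point_def using r(1) by blast
  qed
  show "cone_point (heart_density \<beta> \<gamma> c) 1 \<beta>"
  proof -
    obtain r where r: "r > 0" "\<And>z. z \<in> ball 1 r \<Longrightarrow> z \<notin> {0, q}" using ex_ball_avoiding_finite[of "{0,q}" 1] q_neq by auto
    then have n: "z \<noteq> 0" "z \<noteq> q" if "z \<in> ball 1 r" for z using r(2)[OF that] by auto
    define h where "h = (\<lambda>z. 4 * exp c * cmod (z - q) powr (2 * (\<gamma> - 1)) * (cmod z)\<^sup>2 / (1 + A z)\<^sup>2)"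
    have "continuous_on (ball 1 r) h" unfolding h_def
      by (intro continuous_intros Ac) (use n A in \<open>auto simp: less_imp_neq[THEN not_sym]\<close>)
    moreover have "h z > 0" if "z \<in> ball 1 r" for z
      using n[OF that] A[of z] by (simp add: h_def)
    moreover have "heart_density \<beta> \<gamma> c z = cmod (z - 1) powr (2 * (\<beta> - 1)) * h z" if "z \<in> ball 1 r - {1}" for z
      by (simp add: den h_def)
    ultimately show ?thesis unfolding cone_point_def using r(1) by blast
  qed
  show "cone_point (heart_density \<beta> \<gamma> c) q \<gamma>"
  proof -
    obtain r where r: "r > 0" "\<And>z. z \<in> ball q r \<Longrightarrow> z \<notin> {0, 1}" using ex_ball_avoiding_finite[of "{0,1}" q] q_neq by auto
    then have n: "z \<noteq> 0" "z \<noteq> 1" if "z \<in> ball q r" for z using r(2)[OF that] by auto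
    define h where "h = (\<lambda>z. 4 * exp c * cmod (z - 1) powr (2 * (\<beta> - 1)) * (cmod z)\<^sup>2 / (1 + A z)\<^sup>2)"
    have "continuous_on (ball q r) h" unfolding h_def
      by (intro continuous_intros Ac) (use n A in \<open>auto simp: less_imp_neq[THEN not_sym]\<close>)
    moreover have "h z > 0" if "z \<in> ball q r" for z
      using n[OF that] A[of z] by (simp add: h_def)
    moreover have "heart_density \<beta> \<gamma> c z = cmod (z - q) powr (2 * (\<gamma> - 1)) * h z" if "z \<in> ball q r - {q}" for z
      by (simp add: den h_def)
    ultimately show ?thesis unfolding cone_point_def using r(1) by blast
  qed
qed

text \<open>In w = 1/z the potential is \<open>l w\<close> - 2(\<beta> + \<gamma>) ln |w|. Because
  \<beta> + \<gamma> = 1, the singular part is exactly |w|^(-2) in X, and all powers of |w| outside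
  the denominator cancel against the factor 1 / |w|^4 of the coordinate change.\<close>

lemma smooth_at_infinity: "smooth_at_infinity (heart_density \<beta> \<gamma> c)"
proof -
  obtain r where r: "r > 0" "\<And>z. z \<in> ball 0 r \<Longrightarrow> z \<notin> {1, 1 / q}" using ex_ball_avoiding_finite[of "{1, 1 / q}" 0] q_neq by auto
  have n: "1 - w \<noteq> 0" "1 - q * w \<noteq> 0" if "w \<in> ball 0 r" for w 
    using r(2)[OF that] q_neq by (auto simp: field_simps)
  define l where "l = (\<lambda>w. c + 2 * \<beta> * ln (cmod (1 - w)) + 2 * \<gamma> * ln (cmod (1 - q * w)))"
  define K where "K = (\<lambda>w. of_real \<beta> * (- 1 / (1 - w)) + of_real \<gamma> * (- q / (1 - q * w)))"
  \<comment> \<open>The value at w = 0 causes no trouble, since the bracket |w|^2 + exp l stays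
    positive there.\<close>
  define h where "h = (\<lambda>w. 4 * exp (l w) * inverse (((cmod w)\<^sup>2 + exp (l w)) * ((cmod w)\<^sup>2 + exp (l w)))
      * inverse ((cmod (1 - w))\<^sup>2) * inverse ((cmod (1 - q * w))\<^sup>2))"
  have K: "K holomorphic_on ball 0 r"
    unfolding K_def by (intro holomorphic_intros) (use n in auto)
  have l: "(l has_derivative (\<lambda>v. 2 * Re (K w * v))) (at w)" if w: "w \<in> ball 0 r" for w
  proof -
    have D: "((\<lambda>x. 1 - x) has_field_derivative - 1) (at w)" "((\<lambda>x. 1 - q * x) has_field_derivative - q) (at w)"
      by (auto intro!: derivative_eq_intros)
    have "(l has_derivative (\<lambda>v. 0 + 2 * \<beta> * Re (- 1 / (1 - w) * v) + 2 * \<gamma> * Re (- q / (1 - q * w) * v))) (at w)"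
      unfolding l_def
      by (intro has_derivative_add has_derivative_const has_derivative_mult_right has_derivative_ln_cmod D n w)
    moreover have "0 + 2 * \<beta> * Re (- 1 / (1 - w) * v) + 2 * \<gamma> * Re (- q / (1 - q * w) * v) = 2 * Re (K w * v)" for v
      unfolding K_def distrib_right mult.assoc plus_complex.sel Re_mult_of_real_left by simp
    ultimately show ?thesis by simp
  qed
  have pos: "(cmod w)\<^sup>2 + exp (l w) > 0" for w by (simp add: add_nonneg_pos)
  have "Ck_on k (ball 0 r) h" for k unfolding h_def
    by (intro Ck_on_mult Ck_on_const Ck_on_inverse Ck_on_add Ck_on_exp[OF _ K] Ck_on_cmod_power2 l
        open_ball holomorphic_intros)
       (use n pos in \<open>auto simp: less_imp_neq[THEN not_sym]\<close>)
  then have "smooth_on (ball 0 r) h" by (simp add: smooth_on_def)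
  moreover have "h w > 0" if "w \<in> ball 0 r" for w
    using n[OF that] pos[of w] unfolding h_def by (intro mult_pos_pos) auto
  moreover have "h w = heart_density \<beta> \<gamma> c (1 / w) / cmod w ^ 4" if w: "w \<in> ball 0 r - {0}" for w
  proof -
    have w0: "w \<noteq> 0" "cmod w > 0" using w by auto
    have n': "1 - w \<noteq> 0" "1 - q * w \<noteq> 0" using n w by auto
    have e: "1 / w - 1 = (1 - w) / w" "1 / w - q = (1 - q * w) / w" using w0 by (simp_all add: field_simps)
    have "pot c (1 / w) = l w - 2 * (\<beta> + \<gamma>) * ln (cmod w)"
      using w0 n' unfolding pot_def log_potential_def l_def e norm_divide
      by (simp add: ln_div algebra_simps)
    then have X: "exp (pot c (1 / w)) = exp (l w) / (cmod w)\<^sup>2"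
      using w0 by (simp add: sum exp_diff exp_double)
    have F: "heart_form \<beta> \<gamma> (1 / w) = w / ((1 - w) * (1 - q * w))"
      using w0 n' unfolding form_eq e by (simp add: field_simps)
    have nq: "1 / w \<notin> {1, q}" using e n' w0 by (metis divide_eq_0_iff insert_iff right_minus_eq singletonD)
    show ?thesis
      unfolding density_eq[OF nq] spherical_density_def X F h_def norm_divide norm_mult
      using w0 n' pos[of w] by (simp add: divide_simps power2_eq_square) (simp add: algebra_simps power4_eq_xxxx)
  qed
  ultimately show ?thesis unfolding smooth_at_infinity_def using r(1) by blast
qed

lemma heart_metric: "heart_metric \<beta> \<gamma> (heart_density \<beta> \<gamma> c) 1 q"
proof -
  have o: "open (- {0, 1, q})" by (simp add: open_Compl)
  have nz: "heart_form \<beta> \<gamma> z \<noteq> 0" if "z \<notin> {0, 1, q}" for z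
    using that by (simp add: form_eq)
  have eq: "heart_density \<beta> \<gamma> c z = spherical_density (heart_form \<beta> \<gamma>) (pot c) z" if "z \<notin> {0, 1, q}" for z
    using density_eq that by simp
  \<comment> \<open>The potential also exists at 0, but the metric has a cone point there, so the
    locale is instantiated again on the smaller domain.\<close>
  have "spherical_potential (- {0, 1, q}) (heart_form \<beta> \<gamma>) (pot c)"
    using o hol L by (unfold_locales) (auto intro: holomorphic_on_subset)
  note Ck = spherical_potential.Ck_on_density[OF this]
  have "Ck_on k (- {0, 1, q}) (heart_density \<beta> \<gamma> c)" for k
    by (rule Ck_on_cong[OF o _ Ck]) (simp add: eq)
  then have smooth: "smooth_on (- {0, 1, q}) (heart_density \<beta> \<gamma> c)"
    unfolding smooth_on_def using o by blast
  have pos: "heart_density \<beta> \<gamma> c z > 0" if "z \<in> - {0, 1, q}" for z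
    using density_pos[OF nz, of z c] eq[of z] that by simp
  have curv: "gauss_curv (heart_density \<beta> \<gamma> c) z = 1" if "z \<in> - {0, 1, q}" for z
  proof (rule gauss_curv_density[OF o _ _ _ that])
    fix w assume "w \<in> - {0, 1, q}"
    then show "heart_form \<beta> \<gamma> w \<noteq> 0"
      "heart_density \<beta> \<gamma> c w = spherical_density (heart_form \<beta> \<gamma>) (pot c) w"
      using nz eq by auto
  qed auto
  have "reducible (heart_density \<beta> \<gamma> c) {0, 1, q}"
    by (rule reducible_density[OF o _ nz eq]) auto
  then show ?thesis
    unfolding heart_metric_def
    by (intro conjI ballI q_neq cone_points smooth_at_infinity smooth pos curv one_neq_zero)
qed

lemma character_form: "character_form (heart_density \<beta> \<gamma> c) (heart_form \<beta> \<gamma>)"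
  "simple_pole (at_inf (heart_form \<beta> \<gamma>)) 0" "residue (at_inf (heart_form \<beta> \<gamma>)) 0 = -1"
proof -
  have one: "simple_pole (heart_form \<beta> \<gamma>) 1 \<and> residue (heart_form \<beta> \<gamma>) 1 = of_real \<beta>"
  proof -
    obtain r where r: "r > 0" "\<And>z. z \<in> ball 1 r \<Longrightarrow> z \<notin> {q}" using ex_ball_avoiding_finite[of "{q}" 1] q_neq by auto
    have hol: "(\<lambda>z. z / (z - q)) holomorphic_on ball 1 r"
      using r(2) by (intro holomorphic_intros) auto
    have "simple_pole (heart_form \<beta> \<gamma>) 1" 
      by (rule simple_poleI(1)[OF r(1) hol]) (use q_neq in \<open>auto simp: form_eq mult.commute\<close>)
    moreover have "residue (heart_form \<beta> \<gamma>) 1 = 1 / (1 - q)"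
      by (rule simple_poleI(2)[OF r(1) hol]) (use q_neq in \<open>auto simp: form_eq mult.commute\<close>)
    ultimately show ?thesis by (simp add: residues)
  qed
  have q: "simple_pole (heart_form \<beta> \<gamma>) q \<and> residue (heart_form \<beta> \<gamma>) q = of_real \<gamma>"
  proof -
    obtain r where r: "r > 0" "\<And>z. z \<in> ball q r \<Longrightarrow> z \<notin> {1}" using ex_ball_avoiding_finite[of "{1}" q] q_neq by auto
    have hol: "(\<lambda>z. z / (z - 1)) holomorphic_on ball q r"
      using r(2) by (intro holomorphic_intros) auto
    have "simple_pole (heart_form \<beta> \<gamma>) q" 
      by (rule simple_poleI(1)[OF r(1) hol]) (use q_neq in \<open>auto simp: form_eq mult.commute\<close>)
    moreover have "residue (heart_form \<beta> \<gamma>) q = q / (q - 1)"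
      by (rule simple_poleI(2)[OF r(1) hol]) (use q_neq in \<open>auto simp: form_eq mult.commute\<close>)
    ultimately show ?thesis by (simp add: residues)
  qed
  obtain r where r: "r > 0" "\<And>z. z \<in> ball 0 r \<Longrightarrow> z \<notin> {1, 1 / q}" using ex_ball_avoiding_finite[of "{1, 1 / q}" 0] q_neq by auto
  have n: "1 - w \<noteq> 0" "1 - q * w \<noteq> 0" if "w \<in> ball 0 r" for w 
    using r(2)[OF that] q_neq by (auto simp: field_simps)
  have "(\<lambda>w. - 1 / ((1 - w) * (1 - q * w))) holomorphic_on ball 0 r"
    by (intro holomorphic_intros) (use n in auto)
  moreover have "at_inf (heart_form \<beta> \<gamma>) w = - 1 / ((1 - w) * (1 - q * w)) / (w - 0)"
    if "w \<in> ball 0 r" "w \<noteq> 0" for w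
    using n[OF that(1)] that(2) unfolding at_inf_def form_eq 
    by (simp add: divide_simps power2_eq_square)
  ultimately show inf: "simple_pole (at_inf (heart_form \<beta> \<gamma>)) 0" "residue (at_inf (heart_form \<beta> \<gamma>)) 0 = -1"
    using simple_poleI[OF r(1), of "\<lambda>w. - 1 / ((1 - w) * (1 - q * w))" 0 "at_inf (heart_form \<beta> \<gamma>)"] by simp_all
  \<comment> \<open>\<open>pot\<close> is a primitive of twice the real part, hence the factor 1/2.
    Any additive constant would do; 0 is chosen.\<close>
  have "((\<lambda>z. 1 / 2 * pot 0 z) has_derivative (\<lambda>v. Re (heart_form \<beta> \<gamma> z * v))) (at z)"
    if "z \<in> - {1, q}" for z
    using has_derivative_mult_right[OF L[OF that], of "1 / 2" 0]
    by (rule has_derivative_eq_rhs) (simp add: fun_eq_iff)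
  moreover 
  define \<Phi> where "\<Phi> = (\<lambda>z. 4 * exp (pot c z) / (1 + exp (pot c z)))"
  have "smooth_on (- {1, q}) \<Phi>"
    unfolding smooth_on_def \<Phi>_def using open_S Ck_on_Phi by blast
  moreover have "0 < \<Phi> z \<and> \<Phi> z < 4 \<and>
      (\<Phi> has_derivative (\<lambda>v. \<Phi> z * (4 - \<Phi> z) / 4 * (2 * Re (heart_form \<beta> \<gamma> z * v)))) (at z) \<and>
      heart_density \<beta> \<gamma> c z = \<Phi> z * (4 - \<Phi> z) / 4 * (cmod (heart_form \<beta> \<gamma> z))\<^sup>2"
    if z: "z \<in> - {1, q}" for z
    using Phi_of_potential[OF z, of c] density_eq[of z c] z unfolding \<Phi>_def by (metis ComplD)
  moreover have "\<forall>p\<in>{1, q}. simple_pole (heart_form \<beta> \<gamma>) p \<and> 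
      residue (heart_form \<beta> \<gamma>) p \<in> \<real> \<and> residue (heart_form \<beta> \<gamma>) p \<noteq> 0"
    using one q \<beta> \<gamma> by auto
  moreover have "residue (at_inf (heart_form \<beta> \<gamma>)) 0 \<in> \<real> \<and> residue (at_inf (heart_form \<beta> \<gamma>)) 0 \<noteq> 0"
    using inf by simp
  ultimately show "character_form (heart_density \<beta> \<gamma> c) (heart_form \<beta> \<gamma>)"
    unfolding character_form_def using inf(1) hol 
    apply (intro exI[of _ "{1, q}"])
    apply (intro conjI)
    subgoal by simp
    subgoal by simp
    subgoal by simp
    subgoal by simp
    subgoal by (rule exI[of _ "\<lambda>z. 1 / 2 * pot 0 z"]) simp
    subgoal by (rule exI[of _ \<Phi>]) simp
    done
qed

end

section \<open>Forms with simple poles and one simple zero\<close>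

lemma eventually_at_notin_finite:
  fixes p :: complex
  assumes "finite A"
  shows "\<forall>\<^sub>F z in at p. z \<notin> A"
proof -
  have "\<forall>\<^sub>F z in at p. z \<in> - (A - {p}) - {p}"
    by (rule eventually_at_in_open[OF open_Compl[OF finite_imp_closed[OF finite_Diff[OF assms]]]]) simp
  then show ?thesis by (rule eventually_mono) auto
qed

text \<open>Finite limits make the singularities removable, and nonzero limits keep the extension
  free of zeros.\<close>

lemma zero_free_entire_extension:
  assumes S: "finite S" and F: "F holomorphic_on - S" "\<And>z. z \<notin> S \<Longrightarrow> F z \<noteq> 0"
    and lim: "\<And>p. p \<in> S \<Longrightarrow> \<exists>l. l \<noteq> 0 \<and> (F \<longlongrightarrow> l) (at p)"
  shows "\<exists>E. E holomorphic_on UNIV \<and> (\<forall>z. z \<notin> S \<longrightarrow> E z = F z) \<and> (\<forall>z. E z \<noteq> 0)"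
proof -
  obtain l where l: "\<And>p. p \<in> S \<Longrightarrow> l p \<noteq> 0" "\<And>p. p \<in> S \<Longrightarrow> (F \<longlongrightarrow> l p) (at p)"
    using lim by metis
  define E where "E = (\<lambda>z. if z \<in> S then l z else F z)"
  have "E holomorphic_on UNIV"
  proof (rule no_isolated_singularity'[OF _ _ open_UNIV S])
    show "E holomorphic_on UNIV - S"
      by (rule holomorphic_transform[of F]) (use F in \<open>auto simp: E_def Compl_eq_Diff_UNIV\<close>)
    fix p assume p: "p \<in> S"
    have "\<forall>\<^sub>F z in at p. F z = E z"
      using eventually_at_notin_finite[OF S] by (rule eventually_mono) (simp add: E_def)
    then show "(E \<longlongrightarrow> E p) (at p)"
      using l(2)[OF p] p by (simp add: tendsto_cong E_def)
  qed
  moreover have "E z \<noteq> 0" for z using l F by (simp add: E_def)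
  moreover have "E z = F z" if "z \<notin> S" for z using that by (simp add: E_def)
  ultimately show ?thesis by blast
qed

text \<open>The hypothesis says that E behaves like z^(n-k). If n > k, E tends to infinity and must
  have a zero; if n < k, it tends to 0 and vanishes identically. So n = k, and E tends to 1, hence
  is constant.\<close>

lemma zero_free_entire_asymptotics:
  assumes E: "E holomorphic_on UNIV" "\<And>z. E z \<noteq> 0"
    and lim: "((\<lambda>z. E z * z ^ k / z ^ n) \<longlongrightarrow> 1) at_infinity"
  shows "n = k \<and> (\<forall>z. E z = 1)"
proof -
  have nz: "\<forall>\<^sub>F z in at_infinity. z \<noteq> (0::complex)"
    by (rule eventually_not_equal_at_infinity)
  have "\<not> k < n"
  proof
    assume "k < n"
    have lim': "filterlim (\<lambda>z. (E z * z ^ k / z ^ n) * z ^ (n - k)) at_infinity at_infinity"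
      using \<open>k < n\<close> by (intro tendsto_mult_filterlim_at_infinity[OF lim] filterlim_power_at_infinity filterlim_ident) auto
    have "\<forall>\<^sub>F z in at_infinity. (E z * z ^ k / z ^ n) * z ^ (n - k) = E z"
      using nz by (rule eventually_mono) (use \<open>k < n\<close> in \<open>simp add: power_diff\<close>)
    from filterlim_cong[OF refl refl this] lim' have "filterlim E at_infinity at_infinity"
      by (rule iffD1)
    then have "\<forall>\<^sub>F z in at_infinity. norm (E z) \<ge> B" for B
      using filterlim_at_infinity_imp_norm_at_top[of E] by (simp add: filterlim_at_top)
    then show False
      using Liouville_weak_inverse[OF E(1)] E(2) by metis
  qed
  moreover have "\<not> n < k"
  proof
    assume "n < k"
    have "((\<lambda>z. (E z * z ^ k / z ^ n) * inverse (z ^ (k - n))) \<longlongrightarrow> 1 * 0) at_infinity"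
      using \<open>n < k\<close> by (intro tendsto_mult lim tendsto_inverse_0[THEN filterlim_compose] 
          filterlim_power_at_infinity filterlim_ident) auto
    moreover have "\<forall>\<^sub>F z in at_infinity. (E z * z ^ k / z ^ n) * inverse (z ^ (k - n)) = E z"
      using nz by (rule eventually_mono) (use \<open>n < k\<close> in \<open>simp add: power_diff divide_simps\<close>)
    ultimately have "(E \<longlongrightarrow> 1 * 0) at_infinity"
      by (rule Lim_transform_eventually)
    then show False
      using Liouville_weak[OF E(1)] E(2) by simp
  qed
  ultimately have "n = k" by simp
  have "\<forall>\<^sub>F z in at_infinity. E z * z ^ k / z ^ n = E z"
    using nz by (rule eventually_mono) (simp add: \<open>n = k\<close>)
  with lim have "(E \<longlongrightarrow> 1) at_infinity"
    by (rule Lim_transform_eventually)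
  then show ?thesis
    using Liouville_weak[OF E(1)] \<open>n = k\<close> by blast
qed

lemma tendsto_root_product_at_infinity:
  fixes P :: "complex set"
  shows "((\<lambda>z. (\<Prod>p\<in>P. z - p) / z ^ card P) \<longlongrightarrow> 1) at_infinity"
proof -
  have "((\<lambda>z. (z - p) / z) \<longlongrightarrow> 1) at_infinity" for p :: complex
  proof -
    have "((\<lambda>z. 1 - p * inverse z) \<longlongrightarrow> 1 - p * 0) at_infinity"
      by (intro tendsto_intros tendsto_inverse_0)
    moreover have "\<forall>\<^sub>F z in at_infinity. 1 - p * inverse z = (z - p) / z"
      using eventually_not_equal_at_infinity[of 0] by (rule eventually_mono) (simp add: field_simps)
    ultimately have "((\<lambda>z. (z - p) / z) \<longlongrightarrow> 1 - p * 0) at_infinity"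
      by (rule Lim_transform_eventually)
    then show ?thesis by simp
  qed
  then have "((\<lambda>z. \<Prod>p\<in>P. (z - p) / z) \<longlongrightarrow> (\<Prod>p\<in>P. 1)) at_infinity"
    by (rule tendsto_prod)
  then show ?thesis by (simp add: prod_dividef)
qed

section \<open>Determination of a form from its poles\<close>

lemma simple_pole_tendsto:
  assumes "simple_pole f p"
  shows "residue f p \<noteq> 0" "((\<lambda>z. (z - p) * f z) \<longlongrightarrow> residue f p) (at p)"
proof -
  obtain r g where g: "r > 0" "g holomorphic_on ball p r" "g p \<noteq> 0"
      "\<And>z. z \<in> ball p r \<Longrightarrow> z \<noteq> p \<Longrightarrow> f z = g z / (z - p)"
    using assms unfolding simple_pole_def by blast
  have "isCont g p"
    using g by (metis centre_in_ball continuous_on_interior holomorphic_on_imp_continuous_on interior_open open_ball)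
  then have "(g \<longlongrightarrow> g p) (at p)" by (simp add: isCont_def)
  moreover have "\<forall>\<^sub>F z in at p. z \<in> ball p r - {p}"
    using g(1) by (intro eventually_at_in_open) auto
  then have "\<forall>\<^sub>F z in at p. g z = (z - p) * f z"
    by (rule eventually_mono) (use g(4) in auto)
  ultimately have "((\<lambda>z. (z - p) * f z) \<longlongrightarrow> g p) (at p)"
    by (rule Lim_transform_eventually)
  then show "residue f p \<noteq> 0" "((\<lambda>z. (z - p) * f z) \<longlongrightarrow> residue f p) (at p)"
    using simple_poleI(2)[OF g] g(3) by auto
qed

text \<open>\<open>m P\<close> is the order of the zero at 0, set to 0 when 0 is a pole: that case
  cannot be discarded yet and is decided later by the count
  \<open>card P = Suc (m P)\<close>.\<close>

lemma simple_pole_form_eq: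
  fixes f :: "complex \<Rightarrow> complex"
  defines "m \<equiv> \<lambda>P. if 0 \<in> P then 0 else Suc 0"
  assumes P: "finite P" and f: "f holomorphic_on - P" and poles: "\<And>p. p \<in> P \<Longrightarrow> simple_pole f p"
    and inf: "((\<lambda>z. z * f z) \<longlongrightarrow> 1) at_infinity"
    and nz: "\<And>z. z \<notin> P \<Longrightarrow> z \<noteq> 0 \<Longrightarrow> f z \<noteq> 0" and zero: "0 \<notin> P \<Longrightarrow> f 0 = 0 \<and> deriv f 0 \<noteq> 0"
  shows "card P = Suc (m P) \<and> (\<forall>z. z \<notin> P \<longrightarrow> z \<noteq> 0 \<longrightarrow> f z * (\<Prod>p\<in>P. z - p) = z ^ m P)"
proof -
  define Q where "Q = (\<lambda>z. \<Prod>p\<in>P. z - p)"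
  \<comment> \<open>Multiplying by Q removes the poles and dividing by the power of z removes the
    only possible zero; Liouville's theorem will show that F is 1.\<close>
  define F where "F = (\<lambda>z. f z * Q z / z ^ m P)"
  have Q0: "Q z \<noteq> 0" if "z \<notin> P" for z using that P by (auto simp: Q_def)
  have Qlim: "((\<lambda>z. \<Prod>q\<in>A. z - q) \<longlongrightarrow> (\<Prod>q\<in>A. p - q)) (at p)" for p and A :: "complex set"
    by (intro tendsto_intros)
  have "\<exists>E. E holomorphic_on UNIV \<and> (\<forall>z. z \<notin> insert 0 P \<longrightarrow> E z = F z) \<and> (\<forall>z. E z \<noteq> 0)"
  proof (rule zero_free_entire_extension)
    show "F holomorphic_on - insert 0 P" unfolding F_def Q_def
      by (intro holomorphic_intros holomorphic_on_subset[OF f]) auto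
    show "F z \<noteq> 0" if "z \<notin> insert 0 P" for z
      using that nz Q0 by (simp add: F_def)
    fix p assume "p \<in> insert 0 P"
    show "\<exists>l. l \<noteq> 0 \<and> (F \<longlongrightarrow> l) (at p)"
    proof (cases "p \<in> P")
      case True
      obtain l where l: "l \<noteq> 0" "((\<lambda>z. (z - p) * f z) \<longlongrightarrow> l) (at p)"
        using simple_pole_tendsto[OF poles[OF True]] by blast
      have pm: "p ^ m P \<noteq> 0" using True by (auto simp: m_def)
      define Q' where "Q' = (\<lambda>z. \<Prod>q\<in>P - {p}. z - q)"
      have Q: "Q z = (z - p) * Q' z" for z
        unfolding Q_def Q'_def by (rule prod.remove[OF P True])
      have "((\<lambda>z. ((z - p) * f z) * Q' z / z ^ m P) \<longlongrightarrow> l * Q' p / p ^ m P) (at p)"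
        unfolding Q'_def by (intro tendsto_intros l Qlim pm)
      then have "(F \<longlongrightarrow> l * Q' p / p ^ m P) (at p)"
        by (simp add: F_def Q mult_ac)
      moreover have "Q' p \<noteq> 0" using P by (auto simp: Q'_def)
      ultimately show ?thesis using l pm by (metis divide_eq_0_iff mult_eq_0_iff)
    next
      case False
      then have p: "p = 0" "0 \<notin> P" using \<open>p \<in> insert 0 P\<close> by auto
      have "(f has_field_derivative deriv f 0) (at 0)"
        using holomorphic_derivI[OF f] P p by (simp add: finite_imp_closed open_Compl)
      then have "((\<lambda>z. f z / z) \<longlongrightarrow> deriv f 0) (at 0)"
        using zero[OF p(2)] by (simp add: has_field_derivative_iff)
      then have "((\<lambda>z. f z / z * Q z) \<longlongrightarrow> deriv f 0 * Q 0) (at 0)"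
        unfolding Q_def by (intro tendsto_mult Qlim)
      then have "(F \<longlongrightarrow> deriv f 0 * Q 0) (at p)"
        using p by (simp add: F_def m_def)
      then show ?thesis using zero p Q0 by (metis mult_eq_0_iff)
    qed
  qed (use P in simp)
  then obtain E where E: "E holomorphic_on UNIV" "\<And>z. E z \<noteq> 0" "\<And>z. z \<notin> insert 0 P \<Longrightarrow> E z = F z"
    by blast
  have "((\<lambda>z. (z * f z) * (Q z / z ^ card P)) \<longlongrightarrow> 1 * 1) at_infinity"
    unfolding Q_def by (intro tendsto_mult inf tendsto_root_product_at_infinity)
  \<comment> \<open>The exponent is \<open>Suc (m P)\<close> because the normalisation at infinity
    concerns z f(z), not f(z).\<close>
  moreover have "\<forall>\<^sub>F z in at_infinity. (z * f z) * (Q z / z ^ card P) = E z * z ^ Suc (m P) / z ^ card P"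
  proof -
    have "bounded (insert 0 P)" using P by (simp add: finite_imp_bounded)
    then obtain B where B: "\<forall>z\<in>insert 0 P. norm z \<le> B"
      unfolding bounded_iff by blast
    have "z \<notin> insert 0 P" if "norm z \<ge> B + 1" for z using bspec[OF B, of z] that by linarith
    then have "\<forall>\<^sub>F z in at_infinity. z \<notin> insert 0 P"
      unfolding eventually_at_infinity by blast
    then show ?thesis
      by (rule eventually_mono) (simp add: E(3) F_def)
  qed
  ultimately have "((\<lambda>z. E z * z ^ Suc (m P) / z ^ card P) \<longlongrightarrow> 1 * 1) at_infinity"
    by (rule Lim_transform_eventually)
  then have "((\<lambda>z. E z * z ^ Suc (m P) / z ^ card P) \<longlongrightarrow> 1) at_infinity" by simp
  from zero_free_entire_asymptotics[OF E(1,2) this]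
  have c: "card P = Suc (m P)" and E1: "\<And>z. E z = 1" by auto
  have "f z * Q z = z ^ m P" if "z \<notin> P" "z \<noteq> 0" for z
    using E(3)[of z] E1[of z] that by (simp add: F_def field_simps)
  then show ?thesis using c by (simp add: Q_def)
qed

text \<open>With z = 1/w, w times the form at infinity is -z f(z). The residue thus fixes both the
  decay of \<open>f\<close> and its leading coefficient, which is why the Liouville constant is
  1.\<close>

lemma at_inf_residue_tendsto:
  assumes "simple_pole (at_inf f) 0" "residue (at_inf f) 0 = -1"
  shows "((\<lambda>z. z * f z) \<longlongrightarrow> 1) at_infinity"
proof -
  have "((\<lambda>w. - ((w - 0) * at_inf f w)) \<longlongrightarrow> - (-1)) (at 0)"
    using simple_pole_tendsto[OF assms(1)] assms(2) by (intro tendsto_minus) auto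
  moreover have "- ((w - 0) * at_inf f w) = inverse w * f (inverse w)" if "w \<noteq> 0" for w
    using that by (simp add: at_inf_def power2_eq_square field_simps)
  then have "\<forall>\<^sub>F w in at 0. - ((w - 0) * at_inf f w) = inverse w * f (inverse w)"
    by (simp add: eventually_at_filter)
  ultimately have "((\<lambda>w. inverse w * f (inverse w)) \<longlongrightarrow> 1) (at 0)"
    using tendsto_cong by force
  then show ?thesis
    unfolding lim_at_infinity_0 by (simp add: o_def)
qed

section \<open>Cone angles and residues\<close>

lemma tendsto_cmod_powr_zero:
  assumes "t > 0" shows "((\<lambda>z. cmod (z - p) powr t) \<longlongrightarrow> 0) (at p)"
proof -
  have "((\<lambda>z. cmod (z - p)) \<longlongrightarrow> cmod (p - p)) (at p)" by (intro tendsto_intros)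
  then show ?thesis using assms by (intro tendsto_zero_powrI[where b = t]) auto
qed

lemma powr_multiple_limit_zero:
  fixes h k :: "complex \<Rightarrow> real"
  assumes "(h \<longlongrightarrow> H) (at p)" "(k \<longlongrightarrow> K) (at p)" "t > 0"
    and "\<forall>\<^sub>F z in at p. h z = cmod (z - p) powr t * k z"
  shows "H = 0"
proof -
  have "((\<lambda>z. cmod (z - p) powr t * k z) \<longlongrightarrow> 0 * K) (at p)"
    by (intro tendsto_mult tendsto_cmod_powr_zero assms)
  then have "(h \<longlongrightarrow> 0) (at p)"
    using tendsto_cong[OF assms(4)] by simp
  then show ?thesis using assms(1) tendsto_unique trivial_limit_at by blast
qed

text \<open>If the exponents differed, dividing by the smaller power would force one of the two
  nonzero limits to be 0.\<close>

lemma powr_exponent_unique: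
  fixes h k :: "complex \<Rightarrow> real"
  assumes hk: "(h \<longlongrightarrow> H) (at p)" "(k \<longlongrightarrow> K) (at p)" "H \<noteq> 0" "K \<noteq> 0"
    and eq: "\<forall>\<^sub>F z in at p. cmod (z - p) powr s * h z = cmod (z - p) powr t * k z"
  shows "s = t"
proof -
  have shift: "cmod (z - p) powr u * x = cmod (z - p) powr v * y \<Longrightarrow> z \<noteq> p \<Longrightarrow>
     x = cmod (z - p) powr (v - u) * y" for z u v x y
    by (simp add: powr_diff field_simps)
  have ne: "\<forall>\<^sub>F z in at p. z \<noteq> p" by (simp add: eventually_at_filter)
  have "\<not> s < t"
  proof
    assume "s < t"
    have "\<forall>\<^sub>F z in at p. h z = cmod (z - p) powr (t - s) * k z"
      using eventually_conj[OF eq ne] by (rule eventually_mono) (use shift in blast)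
    from powr_multiple_limit_zero[OF hk(1,2) _ this] show False using hk \<open>s < t\<close> by simp
  qed
  moreover have "\<not> t < s"
  proof
    assume "t < s"
    have "\<forall>\<^sub>F z in at p. k z = cmod (z - p) powr (s - t) * h z"
      using eventually_conj[OF eq ne] by (rule eventually_mono) (metis shift)
    from powr_multiple_limit_zero[OF hk(2,1) _ this] show False using hk \<open>t < s\<close> by simp
  qed
  ultimately show ?thesis by simp
qed

lemma cone_pointD:
  assumes "cone_point \<rho> p \<theta>"
  obtains h where "(h \<longlongrightarrow> h p) (at p)" "h p > 0"
    "\<forall>\<^sub>F z in at p. \<rho> z = cmod (z - p) powr (2 * (\<theta> - 1)) * h z"
proof -
  obtain r h where h: "r > 0" "continuous_on (ball p r) h" "\<forall>z\<in>ball p r. h z > 0"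
      "\<forall>z\<in>ball p r - {p}. \<rho> z = cmod (z - p) powr (2 * (\<theta> - 1)) * h z"
    using assms unfolding cone_point_def by blast
  have "isCont h p"
    using h by (metis centre_in_ball continuous_on_interior interior_open open_ball)
  then have "(h \<longlongrightarrow> h p) (at p)" by (simp add: isCont_def)
  moreover have "\<forall>\<^sub>F z in at p. z \<in> ball p r - {p}"
    using h(1) by (intro eventually_at_in_open) auto
  then have "\<forall>\<^sub>F z in at p. \<rho> z = cmod (z - p) powr (2 * (\<theta> - 1)) * h z"
    by (rule eventually_mono) (use h(4) in auto)
  ultimately show ?thesis using that h by auto
qed

text \<open>For an angle below 2 pi the density blows up at p. Moving the power to the other side
  gives a positive exponent, so a finite limit of the density would force \<open>h p\<close> =
  0.\<close>

lemma cone_point_unbounded: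
  assumes "cone_point \<rho> p \<theta>" "\<theta> < 1" "\<forall>\<^sub>F z in at p. \<rho> z = k z" "(k \<longlongrightarrow> K) (at p)"
  shows False
proof -
  obtain h where h: "(h \<longlongrightarrow> h p) (at p)" "h p > 0"
    "\<forall>\<^sub>F z in at p. \<rho> z = cmod (z - p) powr (2 * (\<theta> - 1)) * h z"
    using cone_pointD[OF assms(1)] .
  have ne: "\<forall>\<^sub>F z in at p. z \<noteq> p" by (simp add: eventually_at_filter)
  have "\<forall>\<^sub>F z in at p. h z = cmod (z - p) powr (2 * (1 - \<theta>)) * k z"
    using eventually_conj[OF eventually_conj[OF h(3) assms(3)] ne]
  proof (rule eventually_mono)
    fix z assume z: "(\<rho> z = cmod (z - p) powr (2 * (\<theta> - 1)) * h z \<and> \<rho> z = k z) \<and> z \<noteq> p"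
    have "cmod (z - p) powr (2 * (1 - \<theta>)) * cmod (z - p) powr (2 * (\<theta> - 1)) = 1"
      using z by (simp add: algebra_simps flip: powr_add)
    moreover have "k z = cmod (z - p) powr (2 * (\<theta> - 1)) * h z" using z by simp
    ultimately show "h z = cmod (z - p) powr (2 * (1 - \<theta>)) * k z"
      by (metis mult.assoc mult_1)
  qed
  from powr_multiple_limit_zero[OF h(1) assms(4) _ this] show False using h assms(2) by simp
qed

text \<open>With r > 0, exp L tends to 0 at a, so the denominator tends to 1 and \<rho> is
  comparable to |z - a|^(2(r-1)). Since a is not 0, the zero of the form does not disturb
  this.\<close>

lemma cone_angle_of_residue:
  assumes cone: "cone_point \<rho> a \<theta>" and "a \<noteq> b" "a \<noteq> 0" "r > 0"
    and f: "\<And>z. z \<notin> {a, b} \<Longrightarrow> f z = z / ((z - a) * (z - b))"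
    and \<rho>: "\<And>z. z \<notin> {a, b} \<Longrightarrow> \<rho> z = spherical_density f (\<lambda>z. c + log_potential a b r s z) z"
  shows "\<theta> = r"
proof -
  obtain h where h: "(h \<longlongrightarrow> h a) (at a)" "h a > 0"
    "\<forall>\<^sub>F z in at a. \<rho> z = cmod (z - a) powr (2 * (\<theta> - 1)) * h z"
    using cone_pointD[OF cone] .
  define k where "k = (\<lambda>z. 4 * exp c * cmod (z - b) powr (2 * s) * (cmod z)\<^sup>2 / (cmod (z - b))\<^sup>2
      / (1 + exp c * cmod (z - a) powr (2 * r) * cmod (z - b) powr (2 * s))\<^sup>2)"
  have "(k \<longlongrightarrow> 4 * exp c * cmod (a - b) powr (2 * s) * (cmod a)\<^sup>2 / (cmod (a - b))\<^sup>2
      / (1 + exp c * 0 * cmod (a - b) powr (2 * s))\<^sup>2) (at a)" (is "(k \<longlongrightarrow> ?K) _")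
    unfolding k_def using assms(2-4) by (intro tendsto_intros tendsto_cmod_powr_zero) auto
  moreover have "?K \<noteq> 0" using assms by simp
  moreover have "\<forall>\<^sub>F z in at a. cmod (z - a) powr (2 * (\<theta> - 1)) * h z = cmod (z - a) powr (2 * (r - 1)) * k z"
    using eventually_conj[OF h(3) eventually_at_notin_finite[of "{a, b}" a, simplified]]
  proof (rule eventually_mono)
    fix z assume z: "\<rho> z = cmod (z - a) powr (2 * (\<theta> - 1)) * h z \<and> z \<noteq> a \<and> z \<noteq> b"
    then have zab: "z \<notin> {a, b}" "z \<noteq> a" "z \<noteq> b" "cmod (z - a) > 0" by auto
    have "\<rho> z = cmod (z - a) powr (2 * (r - 1)) * k z"
      unfolding \<rho>[OF zab(1)] spherical_density_def f[OF zab(1)] exp_log_potential[OF zab(2,3)] 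
        powr_double_minus[OF zab(4)] k_def norm_divide norm_mult
      by (simp add: power_divide power_mult_distrib mult_ac)
    with z show "cmod (z - a) powr (2 * (\<theta> - 1)) * h z = cmod (z - a) powr (2 * (r - 1)) * k z" by simp
  qed
  ultimately have "2 * (\<theta> - 1) = 2 * (r - 1)"
    using h(2) by (intro powr_exponent_unique[OF h(1)]) auto
  then show ?thesis by simp
qed

text \<open>Negating the potential replaces the developing map by its reciprocal. This trades a pole
  with negative residue for one with positive residue.\<close>
lemma spherical_density_uminus:
  "spherical_density f (\<lambda>z. - L z) z = spherical_density f L z"
  unfolding spherical_density_def exp_minus
  using one_plus_exp_neq_0[of "L z"] by (simp add: divide_simps power2_eq_square) (simp add: algebra_simps)

lemma cone_angle_abs_residue:
  assumes cone: "cone_point \<rho> a \<theta>" and "a \<noteq> b" "a \<noteq> 0" "r \<noteq> 0"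
    and f: "\<And>z. z \<notin> {a, b} \<Longrightarrow> f z = z / ((z - a) * (z - b))"
    and \<rho>: "\<And>z. z \<notin> {a, b} \<Longrightarrow> \<rho> z = spherical_density f (\<lambda>z. c + log_potential a b r s z) z"
  shows "\<theta> = \<bar>r\<bar>"
proof (cases "r > 0")
  case True
  then show ?thesis using cone_angle_of_residue[OF assms(1-3) True f \<rho>] by simp
next
  case False
  \<comment> \<open>Only c, r and s change sign; \<open>f\<close> can stay, because the density
    contains it only through |f|.\<close>
  have "\<rho> z = spherical_density f (\<lambda>z. - c + log_potential a b (- r) (- s) z) z" if "z \<notin> {a, b}" for z
    using \<rho>[OF that] spherical_density_uminus[of f "\<lambda>z. c + log_potential a b r s z" z]
    by (simp add: log_potential_def algebra_simps)
  from cone_angle_of_residue[OF assms(1-3) _ f this] show ?thesis using False assms(4) by simp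
qed

section \<open>Uniqueness\<close>

text \<open>\<open>\<psi>\<close> stands for \<Phi>(4 - \<Phi>)/4. Being continuous and positive off
  the poles, it makes \<rho> and |f|^2 comparable there, so the orders of \<open>f\<close> at
  non-poles can be read off the metric.\<close>

lemma character_form_poles:
  assumes metric: "heart_metric \<beta> \<gamma> \<rho> a b" "\<beta> < 1" "\<gamma> < 1"
    and P: "finite P" "f holomorphic_on - P" "\<And>p. p \<in> P \<Longrightarrow> simple_pole f p"
    and inf: "((\<lambda>z. z * f z) \<longlongrightarrow> 1) at_infinity"
    and \<rho>: "\<And>z. z \<notin> P \<Longrightarrow> 0 < \<psi> z \<and> \<rho> z = \<psi> z * (cmod (f z))\<^sup>2" and \<psi>: "continuous_on (- P) \<psi>"
  shows "P = {a, b} \<and> (\<forall>z. z \<notin> {a, b} \<longrightarrow> f z = z / ((z - a) * (z - b)))"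
proof -
  have ab: "a \<noteq> 0" "b \<noteq> 0" "a \<noteq> b"
    and pos: "\<And>z. z \<notin> {0, a, b} \<Longrightarrow> \<rho> z > 0"
    and cones: "cone_point \<rho> 0 2" "cone_point \<rho> a \<beta>" "cone_point \<rho> b \<gamma>"
    using metric(1) unfolding heart_metric_def by auto
  have o: "open (- P)" using P(1) by (simp add: finite_imp_closed open_Compl)
  have lim: "(f \<longlongrightarrow> f p) (at p)" "(\<psi> \<longlongrightarrow> \<psi> p) (at p)" if "p \<notin> P" for p
    using that o \<psi> holomorphic_on_imp_continuous_on[OF P(2)]
    by (auto simp: continuous_on_eq_continuous_at isCont_def)
  have ev: "\<forall>\<^sub>F z in at p. \<rho> z = \<psi> z * (cmod (f z))\<^sup>2" for p
    using eventually_at_notin_finite[OF P(1)] by (rule eventually_mono) (use \<rho> in blast)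
  have "p \<in> P" if "cone_point \<rho> p \<theta>" "\<theta> < 1" for p \<theta>
  proof (rule ccontr)
    assume "p \<notin> P"
    then have "((\<lambda>z. \<psi> z * (cmod (f z))\<^sup>2) \<longlongrightarrow> \<psi> p * (cmod (f p))\<^sup>2) (at p)"
      by (intro tendsto_intros lim)
    from cone_point_unbounded[OF that ev this] show False .
  qed
  then have abP: "a \<in> P" "b \<in> P" using cones metric by blast+
  have nz: "f z \<noteq> 0" if "z \<notin> P" "z \<noteq> 0" for z
  proof -
    have "z \<notin> {0, a, b}" using that abP by auto
    from pos[OF this] \<rho>[OF that(1)] show ?thesis by auto
  qed
  \<comment> \<open>The density tends to 0 at 0, so \<open>f\<close> vanishes there. After division
    by |z|^2 it tends to \<open>h 0\<close> > 0, which must equal \<open>\<psi> 0\<close> times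
    |f'(0)|^2, so the zero is simple.\<close>
  have zero: "f 0 = 0 \<and> deriv f 0 \<noteq> 0" if 0: "0 \<notin> P"
  proof -
    obtain h where h: "(h \<longlongrightarrow> h 0) (at 0)" "h 0 > 0"
      "\<forall>\<^sub>F z in at 0. \<rho> z = cmod (z - 0) powr (2 * (2 - 1)) * h z"
      using cone_pointD[OF cones(1)] .
    have ev2: "\<forall>\<^sub>F z in at 0. z \<noteq> 0 \<and> \<psi> z * (cmod (f z))\<^sup>2 = (cmod z)\<^sup>2 * h z"
      using eventually_conj[OF eventually_conj[OF ev h(3)] eventually_at_notin_finite[of "{0}"]]
      by (rule eventually_mono[of _ "at 0"]) (auto simp: powr_numeral)
    have "((\<lambda>z. (cmod z)\<^sup>2 * h z) \<longlongrightarrow> (cmod 0)\<^sup>2 * h 0) (at 0)"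
      by (intro tendsto_intros h)
    moreover have "\<forall>\<^sub>F z in at 0. (cmod z)\<^sup>2 * h z = \<psi> z * (cmod (f z))\<^sup>2"
      using ev2 by (rule eventually_mono) simp
    ultimately have "((\<lambda>z. \<psi> z * (cmod (f z))\<^sup>2) \<longlongrightarrow> (cmod 0)\<^sup>2 * h 0) (at 0)"
      by (rule Lim_transform_eventually)
    moreover have "((\<lambda>z. \<psi> z * (cmod (f z))\<^sup>2) \<longlongrightarrow> \<psi> 0 * (cmod (f 0))\<^sup>2) (at 0)"
      by (intro tendsto_intros lim 0)
    ultimately have "\<psi> 0 * (cmod (f 0))\<^sup>2 = (cmod 0)\<^sup>2 * h 0"
      using tendsto_unique trivial_limit_at by blast
    then have f0: "f 0 = 0" using \<rho>[OF 0] by auto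
    have "(f has_field_derivative deriv f 0) (at 0)"
      using holomorphic_derivI[OF P(2) o] 0 by simp
    then have "((\<lambda>z. f z / z) \<longlongrightarrow> deriv f 0) (at 0)"
      using f0 by (simp add: has_field_derivative_iff)
    then have "((\<lambda>z. \<psi> z * (cmod (f z / z))\<^sup>2) \<longlongrightarrow> \<psi> 0 * (cmod (deriv f 0))\<^sup>2) (at 0)"
      by (intro tendsto_intros lim 0)
    moreover have "\<forall>\<^sub>F z in at 0. \<psi> z * (cmod (f z / z))\<^sup>2 = h z"
      using ev2 by (rule eventually_mono) (simp add: norm_divide power_divide field_simps)
    ultimately have "(h \<longlongrightarrow> \<psi> 0 * (cmod (deriv f 0))\<^sup>2) (at 0)"
      by (rule Lim_transform_eventually)
    then have "h 0 = \<psi> 0 * (cmod (deriv f 0))\<^sup>2"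
      using h(1) tendsto_unique trivial_limit_at by blast
    then show ?thesis using h(2) f0 by auto
  qed
  from simple_pole_form_eq[OF P inf nz zero]
  have C: "card P = Suc (if 0 \<in> P then 0 else Suc 0)"
    and F: "\<And>z. z \<notin> P \<Longrightarrow> z \<noteq> 0 \<Longrightarrow> f z * (\<Prod>p\<in>P. z - p) = z ^ (if 0 \<in> P then 0 else Suc 0)"
    by blast+
  \<comment> \<open>The count allows one finite pole if 0 is a pole and two otherwise. As a and b
    are poles, 0 is not one and there are no others.\<close>
  have card: "card {a, b} = 2" using ab by simp
  moreover have "card {a, b} \<le> card P" using abP P(1) by (intro card_mono) auto
  ultimately have 0: "0 \<notin> P" and "card P = 2" using C by (auto split: if_splits)
  then have P_eq: "P = {a, b}" using card_subset_eq[OF P(1), of "{a, b}"] abP card by auto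
  have "f z = z / ((z - a) * (z - b))" if z: "z \<notin> {a, b}" for z
  proof (cases "z = 0")
    case True
    then show ?thesis using zero[OF 0] by simp
  next
    case False
    then have "f z * ((z - a) * (z - b)) = z" using F[of z] z 0 ab by (simp add: P_eq)
    moreover have "(z - a) * (z - b) \<noteq> 0" using z by simp
    ultimately show ?thesis by (simp add: nonzero_eq_divide_eq)
  qed
  then show ?thesis using P_eq by blast
qed

text \<open>The differential of ln \<Phi> - ln (4 - \<Phi>) is 4 d\<Phi> / (\<Phi>(4 - \<Phi>)),
  that is 2 Re \<omega>. Since the plane minus two points is connected, one integration constant c
  serves everywhere; this is the parameter of the family.\<close>

lemma spherical_density_potential_unique:
  fixes a b :: complex
  assumes f: "\<And>z. z \<notin> {a, b} \<Longrightarrow> f z = of_real r / (z - a) + of_real s / (z - b)"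
    and \<Phi>: "\<And>z. z \<notin> {a, b} \<Longrightarrow> 0 < \<Phi> z \<and> \<Phi> z < 4 \<and>
      (\<Phi> has_derivative (\<lambda>v. \<Phi> z * (4 - \<Phi> z) / 4 * (2 * Re (f z * v)))) (at z)"
  shows "\<exists>c. \<forall>z. z \<notin> {a, b} \<longrightarrow>
    \<Phi> z * (4 - \<Phi> z) / 4 * (cmod (f z))\<^sup>2 = spherical_density f (\<lambda>z. c + log_potential a b r s z) z"
proof -
  define l where "l = (\<lambda>z. ln (\<Phi> z) - ln (4 - \<Phi> z))"
  have l: "(l has_derivative (\<lambda>v. 2 * Re (f z * v))) (at z)" if z: "z \<notin> {a, b}" for z
  proof -
    have p: "\<Phi> z > 0" "4 - \<Phi> z > 0" and d: "(\<Phi> has_derivative (\<lambda>v. \<Phi> z * (4 - \<Phi> z) / 4 * (2 * Re (f z * v)))) (at z)"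
      using \<Phi>[OF z] by auto
    show ?thesis unfolding l_def
      by (rule has_derivative_eq_rhs[OF has_derivative_diff[OF has_derivative_ln[OF p(1) d] 
           has_derivative_ln[OF p(2) has_derivative_diff[OF has_derivative_const d]]]])
         (use p in \<open>simp add: fun_eq_iff field_simps\<close>)
  qed
  have conn: "connected (- {a, b})"
    using connected_open_delete_finite[of "UNIV :: complex set" "{a, b}"]
    by (simp add: Compl_eq_Diff_UNIV connected_UNIV)
  have const: "l x - log_potential a b r s x = l y - log_potential a b r s y" 
    if "x \<notin> {a, b}" "y \<notin> {a, b}" for x y
  proof (rule has_derivative_zero_unique_connected[of "- {a, b}"])
    fix z assume "z \<in> - {a, b}"
    then have z: "z \<notin> {a, b}" "z \<noteq> a" "z \<noteq> b" by auto
    from has_derivative_diff[OF l[OF z(1)] has_derivative_log_potential[OF z(2,3), of r s, folded f[OF z(1)]]]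
    show "((\<lambda>z. l z - log_potential a b r s z) has_derivative (\<lambda>v. 0)) (at z)" by simp
  qed (use conn that in \<open>auto simp: open_Compl\<close>)
  obtain y where y: "y \<notin> {a, b}"
    using ex_new_if_finite[of "{a, b}"] infinite_UNIV_char_0 by blast
  define c where "c = l y - log_potential a b r s y"
  have "\<Phi> z * (4 - \<Phi> z) / 4 * (cmod (f z))\<^sup>2 = spherical_density f (\<lambda>z. c + log_potential a b r s z) z"
    if z: "z \<notin> {a, b}" for z
  proof -
    have p: "\<Phi> z > 0" "4 - \<Phi> z > 0" using \<Phi>[OF z] by auto
    have "exp (l z) = \<Phi> z / (4 - \<Phi> z)" using p by (simp add: l_def exp_diff)
    moreover have "c + log_potential a b r s z = l z" using const[OF z y] by (simp add: c_def)
    ultimately have X: "exp (c + log_potential a b r s z) = \<Phi> z / (4 - \<Phi> z)" by simp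
    have "1 + \<Phi> z / (4 - \<Phi> z) = 4 / (4 - \<Phi> z)" using p by (simp add: field_simps)
    then show ?thesis
      unfolding spherical_density_def X using p by (simp add: power_divide power2_eq_square)
  qed
  then show ?thesis by blast
qed

text \<open>The coordinate change is multiplication by the cone point a itself: it moves a to 1, and
  the ratio b/a is forced to be \<open>q\<close> by the residues.\<close>

lemma (in heart) uniqueness:
  assumes metric: "heart_metric \<beta> \<gamma> \<rho> a b" and char: "character_form \<rho> f"
    and inf: "simple_pole (at_inf f) 0" "residue (at_inf f) 0 = -1"
  shows "a \<noteq> 0 \<and> (\<forall>z\<in>- {1, q}. a * f (a * z) = heart_form \<beta> \<gamma> z) \<and>
    (\<exists>c. \<forall>z\<in>- {1, q}. \<rho> (a * z) * (cmod a)\<^sup>2 = heart_density \<beta> \<gamma> c z)"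
proof -
  have ab: "a \<noteq> 0" "b \<noteq> 0" "a \<noteq> b" and cones: "cone_point \<rho> a \<beta>" "cone_point \<rho> b \<gamma>"
    using metric unfolding heart_metric_def by auto
  obtain P \<Phi> where P: "finite P" "f holomorphic_on - P" 
      "\<And>p. p \<in> P \<Longrightarrow> simple_pole f p" "\<And>p. p \<in> P \<Longrightarrow> residue f p \<in> \<real>"
    and \<Phi>: "smooth_on (- P) \<Phi>" "\<And>z. z \<notin> P \<Longrightarrow> 0 < \<Phi> z \<and> \<Phi> z < 4 \<and>
              (\<Phi> has_derivative (\<lambda>v. \<Phi> z * (4 - \<Phi> z) / 4 * (2 * Re (f z * v)))) (at z) \<and>
              \<rho> z = \<Phi> z * (4 - \<Phi> z) / 4 * (cmod (f z))\<^sup>2"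
    using char unfolding character_form_def by (elim exE conjE) (metis ComplI)
  have "\<forall>k. Ck_on k (- P) \<Phi>" using \<Phi>(1) by (simp add: smooth_on_def)
  then have "Ck_on 0 (- P) \<Phi>" by blast
  then have \<Phi>c: "continuous_on (- P) \<Phi>" by simp
  have "P = {a, b} \<and> (\<forall>z. z \<notin> {a, b} \<longrightarrow> f z = z / ((z - a) * (z - b)))"
  proof (rule character_form_poles[OF metric _ _ P(1-3) at_inf_residue_tendsto[OF inf]])
    show "\<beta> < 1" "\<gamma> < 1" using \<beta> \<gamma> sum by auto
    show "continuous_on (- P) (\<lambda>z. \<Phi> z * (4 - \<Phi> z) / 4)" by (intro continuous_intros \<Phi>c) simp
    show "0 < \<Phi> z * (4 - \<Phi> z) / 4 \<and> \<rho> z = \<Phi> z * (4 - \<Phi> z) / 4 * (cmod (f z))\<^sup>2" if "z \<notin> P" for z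
      using \<Phi>(2)[OF that] by simp
  qed
  then have P_eq: "P = {a, b}" and f: "\<And>z. z \<notin> {a, b} \<Longrightarrow> f z = z / ((z - a) * (z - b))" by auto
  have res: "residue f a = a / (a - b)"
  proof -
    have "((\<lambda>z. z / (z - b)) \<longlongrightarrow> a / (a - b)) (at a)" using ab by (intro tendsto_intros) auto
    moreover have "\<forall>\<^sub>F z in at a. z / (z - b) = (z - a) * f z"
      using eventually_at_notin_finite[of "{a, b}" a, simplified] by (rule eventually_mono) (simp add: f)
    ultimately have "((\<lambda>z. (z - a) * f z) \<longlongrightarrow> a / (a - b)) (at a)"
      by (rule Lim_transform_eventually)
    moreover have "((\<lambda>z. (z - a) * f z) \<longlongrightarrow> residue f a) (at a)"
      using simple_pole_tendsto[OF P(3), of a] P_eq by auto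
    ultimately show ?thesis using tendsto_unique trivial_limit_at by blast
  qed
  then obtain r where r: "a / (a - b) = of_real r" using P(4)[of a] P_eq by (auto elim: Reals_cases)
  \<comment> \<open>The residues of z / ((z - a)(z - b)) at its two poles add up to 1.\<close>
  define s where "s = 1 - r"
  have s: "b / (b - a) = of_real s" 
  proof -
    have "b / (b - a) = 1 - a / (a - b)" using ab by (simp add: field_simps)
    then show ?thesis by (simp add: r s_def)
  qed
  have rs: "r \<noteq> 0" "s \<noteq> 0" using r s ab by auto
  have pf: "f z = of_real r / (z - a) + of_real s / (z - b)" if "z \<notin> {a, b}" for z
    unfolding f[OF that] r[symmetric] s[symmetric] using that ab
    by (simp add: divide_simps) (simp add: algebra_simps)
  obtain c where c: "\<And>z. z \<notin> {a, b} \<Longrightarrow>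
      \<Phi> z * (4 - \<Phi> z) / 4 * (cmod (f z))\<^sup>2 = spherical_density f (\<lambda>z. c + log_potential a b r s z) z"
    using spherical_density_potential_unique[OF pf, of \<Phi>] \<Phi>(2) P_eq by blast
  have \<rho>: "\<rho> z = spherical_density f (\<lambda>z. c + log_potential a b r s z) z" if "z \<notin> {a, b}" for z
    using \<Phi>(2)[of z] c[OF that] that P_eq by simp
  have "\<beta> = \<bar>r\<bar>"
    by (rule cone_angle_abs_residue[OF cones(1) ab(3,1) rs(1) f \<rho>])
  moreover have "\<gamma> = \<bar>s\<bar>"
  \<comment> \<open>The same lemma with the roles of a and b, and of r and s, exchanged.\<close>
  proof (rule cone_angle_abs_residue[OF cones(2) ab(3)[symmetric] ab(2) rs(2)])
    fix z assume "z \<notin> {b, a}"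
    then have z: "z \<notin> {a, b}" by auto
    show "f z = z / ((z - b) * (z - a))" using f[OF z] by (simp add: mult.commute)
    show "\<rho> z = spherical_density f (\<lambda>z. c + log_potential b a s r z) z"
      using \<rho>[OF z] by (simp add: log_potential_def spherical_density_def add_ac)
  qed
  \<comment> \<open>Here |r| + |s| = \<beta> + \<gamma> = 1 = r + s, which leaves no room for a
    negative residue.\<close>
  ultimately have "r = \<beta>" "s = \<gamma>" using \<beta> \<gamma> sum by (auto simp: s_def)
  have "b = a * q"
  proof -
    have "a / (a - b) = 1 / (1 - q)" using r \<open>r = \<beta>\<close> residues(1) by simp
    then show ?thesis using ab q_neq by (simp add: divide_simps) (simp add: algebra_simps)
  qed
  have nab: "a * z \<notin> {a, b}" if "z \<in> - {1, q}" for z using that ab(1) \<open>b = a * q\<close> by auto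
  have scale: "a * f (a * z) = heart_form \<beta> \<gamma> z" if "z \<in> - {1, q}" for z
  proof -
    have "a * z - a = a * (z - 1)" "a * z - b = a * (z - q)" by (simp_all add: \<open>b = a * q\<close> algebra_simps)
    then show ?thesis unfolding f[OF nab[OF that]] form_eq using ab by simp
  qed
  \<comment> \<open>Each ln |az - pole| gains ln |a|, with total weight 2(\<beta> + \<gamma>) = 2;
    this is the shift of c. The factor |a|^2 on the left turns f(az) into the rescaled form a
    f(az).\<close>
  have "\<rho> (a * z) * (cmod a)\<^sup>2 = heart_density \<beta> \<gamma> (c + 2 * ln (cmod a)) z" if z: "z \<in> - {1, q}" for z
  proof -
    have dist: "a * z - a = a * (z - 1)" "a * z - b = a * (z - q)"
      by (simp_all add: \<open>b = a * q\<close> algebra_simps)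
    have "log_potential a b r s (a * z) = 2 * (\<beta> + \<gamma>) * ln (cmod a) + log_potential 1 q \<beta> \<gamma> z"
      using ab(1) z unfolding log_potential_def dist norm_mult
      by (subst (1 2) ln_mult) (auto simp: \<open>r = \<beta>\<close> \<open>s = \<gamma>\<close> algebra_simps)
    then have p: "c + log_potential a b r s (a * z) = pot (c + 2 * ln (cmod a)) z"
      by (simp add: pot_def sum)
    have "z \<notin> {1, q}" using z by simp
    then show ?thesis
      unfolding \<rho>[OF nab[OF z]] density_eq[OF \<open>z \<notin> {1, q}\<close>] spherical_density_def p 
        scale[OF z, symmetric] norm_mult by (simp add: power_mult_distrib)
  qed
  then show ?thesis using ab(1) scale by blast
qed

theorem theorem1p2:
  fixes \<beta> \<gamma> :: real
  assumes "0 < \<beta>" "\<beta> < 1" "0 < \<gamma>" "\<gamma> < 1" "\<beta> + \<gamma> = 1"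
  shows
    "(\<forall>(\<rho> :: complex \<Rightarrow> real) (f :: complex \<Rightarrow> complex) (a :: complex) (b :: complex).
        heart_metric \<beta> \<gamma> \<rho> a b \<and> character_form \<rho> f \<and>
        simple_pole (at_inf f) 0 \<and> residue (at_inf f) 0 = -1 \<longrightarrow>
        (\<exists>p::complex. p \<noteq> 0 \<and>
           (\<forall>z\<in>- {1, - complex_of_real (\<gamma> / \<beta>)}. p * f (p * z) = heart_form \<beta> \<gamma> z) \<and>
           (\<exists>c::real. \<forall>z\<in>- {0, 1, - complex_of_real (\<gamma> / \<beta>)}.
              \<rho> (p * z) * (cmod p)\<^sup>2 = heart_density \<beta> \<gamma> c z)))
     \<and> (\<forall>c::real.
          heart_metric \<beta> \<gamma> (heart_density \<beta> \<gamma> c) 1 (- complex_of_real (\<gamma> / \<beta>)) \<and>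
          character_form (heart_density \<beta> \<gamma> c) (heart_form \<beta> \<gamma>) \<and>
          simple_pole (at_inf (heart_form \<beta> \<gamma>)) 0 \<and>
          residue (at_inf (heart_form \<beta> \<gamma>)) 0 = -1)"
proof -
  interpret heart \<beta> \<gamma> by unfold_locales (use assms in auto)
  show ?thesis
    unfolding q_def[symmetric]
  proof (intro conjI allI impI; (elim conjE)?)
    fix \<rho> f a b
    assume "heart_metric \<beta> \<gamma> \<rho> a b" "character_form \<rho> f" 
      "simple_pole (at_inf f) 0" "residue (at_inf f) 0 = -1"
    from uniqueness[OF this]
    show "\<exists>p. p \<noteq> 0 \<and> (\<forall>z\<in>- {1, q}. p * f (p * z) = heart_form \<beta> \<gamma> z) \<and>
        (\<exists>c. \<forall>z\<in>- {0, 1, q}. \<rho> (p * z) * (cmod p)\<^sup>2 = heart_density \<beta> \<gamma> c z)"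
      by (intro exI[of _ a]) blast
  qed (fact heart_metric character_form)+
qed

end
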